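(* Consider the homogeneous post-local algorithm (see context) with deterministic schedules $(\vartheta_t)$, $(\Lambda_t)$ satisfying $L<\Lambda_t\le2L$ and $\Lambda_t\vartheta_t\le L/2$ for every $t\ge0$. Then, for every $t\ge0$, $$g_{t+1}\le T_{A_t^{\mathrm{hom}}}(g_t)+\beta_t^{\mathrm{hom}}g_t+\delta_t^{\mathrm{hom}},$$ where $A_t^{\mathrm{hom}}:=\frac{\vartheta_t}{4LR^2}$, $$\beta_t^{\mathrm{hom}}:=16\vartheta_t^3+16\frac{L\vartheta_t^2}{\Lambda_t-L},\qquad \delta_t^{\mathrm{hom}}:=\Bigl(4\frac{\vartheta_t^3}L+4\frac{\vartheta_t^2}{\Lambda_t-L}\Bigr)\bar V_1+\Bigl(\frac{\vartheta_t}L+\frac1{\Lambda_t-L}\Bigr)V_u.$$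
   Context: Problem: $F(x)=\frac1n\sum_{i=1}^nF_i(x)$, $F_i(x)=\frac1{m_i}\sum_{j=1}^{m_i}\phi_{ij}(x)$, each $\phi_{ij}:\mathbb R^d\to\mathbb R$ convex and $L$-smooth ($L$-Lipschitz gradient). There are $x_\star\in\arg\min F$ and $R>0$; $B(x_\star,R)=\{x:\|x-x_\star\|\le R\}$, $F_\star:=F(x_\star)$. Node $i$ has horizon $H_i\ge1$, minibatch size $b_i$, and $v_i^2:=\sup_{x\in B(x_\star,R)}\frac1{m_i}\sum_j\|\nabla\phi_{ij}(x)-\nabla F_i(x)\|^2$. Homogeneous post-local algorithm (all nodes active). In round $t$, with amplitude $\vartheta_t\in[\underline\theta,\bar\theta]$ ($0<\underline\theta\le\bar\theta$) and curvature $\Lambda_t>L$, each $i\in[n]$ sets $\eta_{i,t}=\vartheta_t/(LH_i)$, $y_{i,t}^{(0)}=x_t$ and, for $\ell=0,\dots,H_i-1$, draws a minibatch $\mathcal B_{i,t,\ell}$, computes a stochastic gradient $g_{i,t,\ell}$ and sets $y_{i,t}^{(\ell+1)}=y_{i,t}^{(\ell)}-\eta_{i,t}g_{i,t,\ell}$. Put $\Delta_{i,t}=y_{i,t}^{(H_i)}-x_t$, $g_{i,t}^{\mathrm{loc}}=-(\eta_{i,t}H_i)^{-1}\Delta_{i,t}$, $\bar g_t=\frac1n\sum_ig_{i,t}^{\mathrm{loc}}$, $$\Psi_t^{\mathrm{hom}}(w)=\Bigl\langle\bar g_t,\sum_iw_i\Delta_{i,t}\Bigr\rangle+\frac{\Lambda_t}2\Bigl\|\sum_iw_i\Delta_{i,t}\Bigr\|^2.$$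 The server picks $w_t^{\mathrm{hom}}\in\arg\min_{w\in\Delta_n}\Psi_t^{\mathrm{hom}}(w)$, $\Delta_n=\{w\in\mathbb R_+^n:\sum_iw_i=1\}$ (measurably), and sets $x_{t+1}=x_t+\sum_iw_{i,t}^{\mathrm{hom}}\Delta_{i,t}$. Standing assumptions: almost surely $x_t,y_{i,t}^{(\ell)}\in B(x_\star,R)$ for all $t,i,\ell$. $\mathcal F_t$ is generated by the initial state and all minibatches drawn strictly before round $t$; $\mathcal G_{i,t,\ell}$ by $\mathcal F_t$ and all minibatches of node $i$ drawn strictly before local step $\ell$ of round $t$. Conditionally on $\mathcal G_{i,t,\ell}$ the minibatches are independent across nodes and local steps. Homogeneous oracle condition: $\mathbb E[g_{i,t,\ell}\mid\mathcal G_{i,t,\ell}]=\nabla F(y_{i,t}^{(\ell)})$ and $\mathbb E[\|g_{i,t,\ell}-\nabla F(y_{i,t}^{(\ell)})\|^2\mid\mathcal G_{i,t,\ell}]\le v_i^2/b_i$ for every node $i$ and local step $\ell$. Notation: $g_t:=\mathbb E[F(x_t)-F_\star]$; $T_a(u):=\frac u{1+au}$; $\bar V_1:=\frac1n\sum_i\frac{v_i^2}{H_ib_i}$; $V_u:=\frac1{n^2}\sum_i\frac{v_i^2}{H_ib_i}$. *)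

theory Defs
  imports "HOL-Probability.Probability"
begin

section \<open>Smooth finite-sum problem\<close>

definition grad :: "('a::real_inner \<Rightarrow> real) \<Rightarrow> 'a \<Rightarrow> 'a" where
  "grad f x = (THE D. GDERIV f x :> D)"

definition L_smooth :: "real \<Rightarrow> ('a::real_inner \<Rightarrow> real) \<Rightarrow> bool" where
  "L_smooth L f \<longleftrightarrow> (\<forall>x. f differentiable (at x)) \<and> L-lipschitz_on UNIV (grad f)"

text \<open>The nodes are the elements of a finite type \<open>'n\<close>, so the number of nodes is \<open>CARD('n)\<close>.
  The components of node \<open>i\<close> are \<open>\<phi> i j\<close> with \<open>j < m i\<close>.\<close>

definition node_obj :: "('n \<Rightarrow> nat) \<Rightarrow> ('n \<Rightarrow> nat \<Rightarrow> real^'d \<Rightarrow> real) \<Rightarrow> 'n \<Rightarrow> real^'d \<Rightarrow> real" where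
  "node_obj m \<phi> i x = (1 / real (m i)) * (\<Sum>j<m i. \<phi> i j x)"

definition global_obj ::
  "('n::finite \<Rightarrow> nat) \<Rightarrow> ('n \<Rightarrow> nat \<Rightarrow> real^'d \<Rightarrow> real) \<Rightarrow> real^'d \<Rightarrow> real" where
  "global_obj m \<phi> x = (1 / real CARD('n)) * (\<Sum>i\<in>UNIV. node_obj m \<phi> i x)"

text \<open>\<open>node_var m \<phi> xs R i\<close> is \<open>v\<^sub>i\<^sup>2\<close>. For smooth components the supremum is over a nonempty set
  that is bounded above, so it is a genuine real supremum.\<close>

definition node_var ::
  "('n \<Rightarrow> nat) \<Rightarrow> ('n \<Rightarrow> nat \<Rightarrow> real^'d \<Rightarrow> real) \<Rightarrow> real^'d \<Rightarrow> real \<Rightarrow> 'n \<Rightarrow> real" where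
  "node_var m \<phi> xs R i =
     (SUP x\<in>cball xs R. (1 / real (m i)) *
        (\<Sum>j<m i. (norm (grad (\<phi> i j) x - grad (node_obj m \<phi> i) x))\<^sup>2))"

section \<open>Conditional expectation and conditional independence\<close>

definition vec_cond_exp ::
  "'w measure \<Rightarrow> 'w measure \<Rightarrow> ('w \<Rightarrow> real^'d) \<Rightarrow> 'w \<Rightarrow> real^'d" where
  "vec_cond_exp M G f \<omega> = (\<chi> k. real_cond_exp M G (\<lambda>\<omega>'. f \<omega>' $ k) \<omega>)"

definition cond_indep_vars ::
  "'w measure \<Rightarrow> 'w measure \<Rightarrow> ('i \<Rightarrow> 'b measure) \<Rightarrow> ('i \<Rightarrow> 'w \<Rightarrow> 'b) \<Rightarrow> 'i set \<Rightarrow> bool" where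
  "cond_indep_vars M G N X I \<longleftrightarrow>
     (\<forall>J\<subseteq>I. finite J \<longrightarrow> (\<forall>A. (\<forall>j\<in>J. A j \<in> sets (N j)) \<longrightarrow>
        (AE \<omega> in M.
           real_cond_exp M G (indicat_real {\<omega>' \<in> space M. \<forall>j\<in>J. X j \<omega>' \<in> A j}) \<omega> =
           (\<Prod>j\<in>J. real_cond_exp M G (indicat_real {\<omega>' \<in> space M. X j \<omega>' \<in> A j}) \<omega>))))"

section \<open>The filtrations of the algorithm\<close>

text \<open>A minibatch is a list of component indices (so sampling with or without replacement is
  covered); \<open>B i t l\<close> is the minibatch of node \<open>i\<close> at local step \<open>l < H i\<close> of round \<open>t\<close>,
  and \<open>x0\<close> is the initial state. \<open>round_hist\<close> is \<open>\<F>\<^sub>t\<close> and \<open>local_hist\<close> is \<open>\<G>\<close>.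
  Only the underlying sigma-algebras of these two measures matter.\<close>

definition round_hist ::
  "'w measure \<Rightarrow> ('n \<Rightarrow> nat) \<Rightarrow> ('n \<Rightarrow> nat \<Rightarrow> nat \<Rightarrow> 'w \<Rightarrow> nat list) \<Rightarrow> ('w \<Rightarrow> real^'d) \<Rightarrow>
   nat \<Rightarrow> 'w measure" where
  "round_hist M H B x0 t = sigma (space M)
     (sets (vimage_algebra (space M) x0 borel) \<union>
      (\<Union>s<t. \<Union>i. \<Union>l<H i. sets (vimage_algebra (space M) (B i s l) (count_space UNIV))))"

definition local_hist ::
  "'w measure \<Rightarrow> ('n \<Rightarrow> nat) \<Rightarrow> ('n \<Rightarrow> nat \<Rightarrow> nat \<Rightarrow> 'w \<Rightarrow> nat list) \<Rightarrow> ('w \<Rightarrow> real^'d) \<Rightarrow>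
   'n \<Rightarrow> nat \<Rightarrow> nat \<Rightarrow> 'w measure" where
  "local_hist M H B x0 i t l = sigma (space M)
     (sets (round_hist M H B x0 t) \<union>
      (\<Union>k<l. sets (vimage_algebra (space M) (B i t k) (count_space UNIV))))"

section \<open>The homogeneous post-local algorithm\<close>

definition unit_simplex :: "(real^'n::finite) set" where
  "unit_simplex = {w. (\<forall>i. 0 \<le> w $ i) \<and> (\<Sum>i\<in>UNIV. w $ i) = 1}"

text \<open>In the following definitions \<open>\<Delta> i\<close> is the displacement of node \<open>i\<close> in one round and
  \<open>\<eta> i\<close> its step size in that round.\<close>

definition avg_local_grad ::
  "('n::finite \<Rightarrow> nat) \<Rightarrow> ('n \<Rightarrow> real) \<Rightarrow> ('n \<Rightarrow> real^'d) \<Rightarrow> real^'d" where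
  "avg_local_grad H \<eta> \<Delta> =
     (1 / real CARD('n)) *\<^sub>R (\<Sum>i\<in>UNIV. - inverse (\<eta> i * real (H i)) *\<^sub>R \<Delta> i)"

definition Psi_hom ::
  "('n::finite \<Rightarrow> nat) \<Rightarrow> ('n \<Rightarrow> real) \<Rightarrow> real \<Rightarrow> ('n \<Rightarrow> real^'d) \<Rightarrow> real^'n \<Rightarrow> real" where
  "Psi_hom H \<eta> \<Lambda> \<Delta> w =
     avg_local_grad H \<eta> \<Delta> \<bullet> (\<Sum>i\<in>UNIV. w $ i *\<^sub>R \<Delta> i)
     + \<Lambda> / 2 * (norm (\<Sum>i\<in>UNIV. w $ i *\<^sub>R \<Delta> i))\<^sup>2"

definition step_size :: "real \<Rightarrow> ('n \<Rightarrow> nat) \<Rightarrow> real \<Rightarrow> 'n \<Rightarrow> real" where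
  "step_size L H \<theta> i = \<theta> / (L * real (H i))"

text \<open>The stochastic gradient \<open>g i t l\<close> may be any quantity computed from the minibatch
  \<open>B i t l\<close> and the previous information of node \<open>i\<close>, i.e. it is measurable with respect to
  \<open>local_hist\<close> at \<open>Suc l\<close>. Likewise the server selects the weights \<open>w t\<close> measurably from the
  information available at the end of round \<open>t\<close>. The second-moment bound uses the
  \<open>ennreal\<close>-valued conditional expectation, so it includes finiteness of the second moment.\<close>

locale hom_post_local = prob_space M
  for M :: "'w measure"
    and m :: "'n::finite \<Rightarrow> nat"
    and \<phi> :: "'n \<Rightarrow> nat \<Rightarrow> real^'d \<Rightarrow> real"
    and L :: real and xs :: "real^'d" and R :: real
    and H b :: "'n \<Rightarrow> nat"
    and \<theta>lo \<theta>hi :: real and \<theta> \<Lambda> :: "nat \<Rightarrow> real"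
    and B :: "'n \<Rightarrow> nat \<Rightarrow> nat \<Rightarrow> 'w \<Rightarrow> nat list"
    and g :: "'n \<Rightarrow> nat \<Rightarrow> nat \<Rightarrow> 'w \<Rightarrow> real^'d"
    and y :: "'n \<Rightarrow> nat \<Rightarrow> nat \<Rightarrow> 'w \<Rightarrow> real^'d"
    and w :: "nat \<Rightarrow> 'w \<Rightarrow> real^'n"
    and x :: "nat \<Rightarrow> 'w \<Rightarrow> real^'d" +
  assumes L_pos: "0 < L" and R_pos: "0 < R"
    and m_pos: "\<And>i. 1 \<le> m i" and H_pos: "\<And>i. 1 \<le> H i" and b_pos: "\<And>i. 1 \<le> b i"
    and convex: "\<And>i j. j < m i \<Longrightarrow> convex_on UNIV (\<phi> i j)"
    and smooth: "\<And>i j. j < m i \<Longrightarrow> L_smooth L (\<phi> i j)"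
    and minimizer: "is_arg_min (global_obj m \<phi>) (\<lambda>_. True) xs"
    and \<theta>_bounds: "0 < \<theta>lo" "\<theta>lo \<le> \<theta>hi"
    and \<theta>_range: "\<And>t. \<theta> t \<in> {\<theta>lo..\<theta>hi}"
    and \<Lambda>_gt: "\<And>t. L < \<Lambda> t"
    and init_measurable: "x 0 \<in> borel_measurable M"
    and batch_measurable:
      "\<And>i t l. l < H i \<Longrightarrow> B i t l \<in> measurable M (count_space UNIV)"
    and batch_size:
      "\<And>i t l \<omega>. l < H i \<Longrightarrow> \<omega> \<in> space M \<Longrightarrow>
         length (B i t l \<omega>) = b i \<and> set (B i t l \<omega>) \<subseteq> {..<m i}"
    and grad_measurable:
      "\<And>i t l. l < H i \<Longrightarrow>
         g i t l \<in> borel_measurable (local_hist M H B (x 0) i t (Suc l))"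
    and local_init: "\<And>i t \<omega>. \<omega> \<in> space M \<Longrightarrow> y i t 0 \<omega> = x t \<omega>"
    and local_step:
      "\<And>i t l \<omega>. l < H i \<Longrightarrow> \<omega> \<in> space M \<Longrightarrow>
         y i t (Suc l) \<omega> = y i t l \<omega> - step_size L H (\<theta> t) i *\<^sub>R g i t l \<omega>"
    and weights_argmin:
      "\<And>t \<omega>. \<omega> \<in> space M \<Longrightarrow>
         is_arg_min
           (Psi_hom H (step_size L H (\<theta> t)) (\<Lambda> t) (\<lambda>i. y i t (H i) \<omega> - x t \<omega>))
           (\<lambda>v. v \<in> unit_simplex) (w t \<omega>)"
    and weights_measurable:
      "\<And>t. w t \<in> borel_measurable (round_hist M H B (x 0) (Suc t))"
    and server_step:
      "\<And>t \<omega>. \<omega> \<in> space M \<Longrightarrow>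
         x (Suc t) \<omega> = x t \<omega> + (\<Sum>i\<in>UNIV. w t \<omega> $ i *\<^sub>R (y i t (H i) \<omega> - x t \<omega>))"
    and x_in_ball: "\<And>t. AE \<omega> in M. x t \<omega> \<in> cball xs R"
    and y_in_ball: "\<And>i t l. l \<le> H i \<Longrightarrow> AE \<omega> in M. y i t l \<omega> \<in> cball xs R"
    and batches_cond_indep:
      "\<And>i t l. l < H i \<Longrightarrow>
         cond_indep_vars M (local_hist M H B (x 0) i t l) (\<lambda>_. count_space UNIV)
           (\<lambda>(j, k). B j t k) (SIGMA j:UNIV. {..<H j})"
    and oracle_mean:
      "\<And>i t l. l < H i \<Longrightarrow>
         AE \<omega> in M. vec_cond_exp M (local_hist M H B (x 0) i t l) (g i t l) \<omega>
           = grad (global_obj m \<phi>) (y i t l \<omega>)"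
    and oracle_variance:
      "\<And>i t l. l < H i \<Longrightarrow>
         AE \<omega> in M. nn_cond_exp M (local_hist M H B (x 0) i t l)
             (\<lambda>\<omega>'. ennreal ((norm (g i t l \<omega>' - grad (global_obj m \<phi>) (y i t l \<omega>')))\<^sup>2)) \<omega>
           \<le> ennreal (node_var m \<phi> xs R i / real (b i))"

section \<open>The quantities of the recursion\<close>

definition exp_gap ::
  "'w measure \<Rightarrow> ('n::finite \<Rightarrow> nat) \<Rightarrow> ('n \<Rightarrow> nat \<Rightarrow> real^'d \<Rightarrow> real) \<Rightarrow> real^'d \<Rightarrow>
   (nat \<Rightarrow> 'w \<Rightarrow> real^'d) \<Rightarrow> nat \<Rightarrow> real" where
  "exp_gap M m \<phi> xs x t =
     prob_space.expectation M (\<lambda>\<omega>. global_obj m \<phi> (x t \<omega>) - global_obj m \<phi> xs)"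

definition T_map :: "real \<Rightarrow> real \<Rightarrow> real" where
  "T_map a u = u / (1 + a * u)"

definition V_bar1 :: "('n::finite \<Rightarrow> real) \<Rightarrow> ('n \<Rightarrow> nat) \<Rightarrow> ('n \<Rightarrow> nat) \<Rightarrow> real" where
  "V_bar1 v2 H b = (1 / real CARD('n)) * (\<Sum>i\<in>UNIV. v2 i / (real (H i) * real (b i)))"

definition V_u :: "('n::finite \<Rightarrow> real) \<Rightarrow> ('n \<Rightarrow> nat) \<Rightarrow> ('n \<Rightarrow> nat) \<Rightarrow> real" where
  "V_u v2 H b = (1 / (real CARD('n))\<^sup>2) * (\<Sum>i\<in>UNIV. v2 i / (real (H i) * real (b i)))"

definition A_hom :: "real \<Rightarrow> real \<Rightarrow> real \<Rightarrow> real" where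
  "A_hom L R \<theta> = \<theta> / (4 * L * R\<^sup>2)"

definition beta_hom :: "real \<Rightarrow> real \<Rightarrow> real \<Rightarrow> real" where
  "beta_hom L \<theta> \<Lambda> = 16 * \<theta> ^ 3 + 16 * (L * \<theta>\<^sup>2 / (\<Lambda> - L))"

text \<open>The last two arguments of \<open>delta_hom\<close> are the values of \<open>V_bar1\<close> and \<open>V_u\<close>.\<close>

definition delta_hom :: "real \<Rightarrow> real \<Rightarrow> real \<Rightarrow> real \<Rightarrow> real \<Rightarrow> real" where
  "delta_hom L \<theta> \<Lambda> V1 Vu =
     (4 * (\<theta> ^ 3 / L) + 4 * (\<theta>\<^sup>2 / (\<Lambda> - L))) * V1 + (\<theta> / L + 1 / (\<Lambda> - L)) * Vu"

end

theory Submission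
  imports Defs
begin

text \<open>
  Write \<open>h\<close> for the averaged local gradient of a round, \<open>c = \<theta> / L\<close>, and \<open>e\<close> for the error
  \<open>h - grad F x\<close> at the start of the round. The step size of each node makes its displacement equal to
  \<open>- c\<close> times its local gradient, so uniform weights give the step \<open>- c *\<^sub>R h\<close>, and the chosen
  weights have a surrogate value at most that of this step. The descent lemma for the smooth objective, with
  the curvature excess \<open>\<Lambda> - L\<close> spent on Young's inequality for \<open>e\<close>, gives a decrease of
  \<open>c / 4\<close> times the squared gradient up to the error \<open>(c + 1 / (\<Lambda> - L)) / 2\<close> times the square of \<open>e\<close>
  (\<open>surrogate_descent\<close>, \<open>round_descent\<close>). Convexity on the ball bounds the gradient below by the gap over
  \<open>R\<close>. Taking expectations, the squared mean gap is at most the mean squared gap, and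
  \<open>u - A * u\<^sup>2 \<le> T_map A u\<close> yields the first term of the recursion.

  It remains to bound the second moment of \<open>e\<close>, which is the sum of an averaged noise and an averaged
  drift (\<open>mean_grad_error\<close>). The noise terms of a round are pairwise uncorrelated
  (\<open>noise_orthogonal\<close>), so their weighted sum has second moment at most \<open>V_u\<close>. On one node this is
  the martingale difference property. On two different nodes it rests on conditional independence: given
  the history of the round, revealing the minibatches of one node does not change the vanishing conditional
  mean of the noise of another one (\<open>cond_indep_cond_exp_zero\<close>). The drift is controlled by a recursion for
  the mean squared distance of the local iterates from the start of the round, summed over the round
  (\<open>drift_recursion\<close>), and by bounding the squared gradient by \<open>2 * L\<close> times the gap.
\<close>

section \<open>Smooth convex functions\<close>

lemma grad_eqI:
  assumes "GDERIV f x :> D"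
  shows "grad f x = D"
  unfolding grad_def
proof (rule the_equality)
  show "GDERIV f x :> D" by fact
next
  fix D' assume "GDERIV f x :> D'"
  with assms have "(\<lambda>h. h \<bullet> D) = (\<lambda>h. h \<bullet> D')"
    unfolding gderiv_def by (rule has_derivative_unique)
  then have "(D' - D) \<bullet> (D' - D) = 0"
    by (metis diff_self inner_diff_right)
  then show "D' = D" by simp
qed

lemma differentiable_GDERIV_grad:
  fixes f :: "'a::euclidean_space \<Rightarrow> real"
  assumes "f differentiable (at x)"
  shows "GDERIV f x :> grad f x"
proof -
  obtain f' where f': "(f has_derivative f') (at x)"
    using assms unfolding differentiable_def by blast
  then interpret bounded_linear f' by (rule has_derivative_bounded_linear)
  have "f' h = h \<bullet> adjoint f' 1" for h
    using adjoint_works[OF linear_axioms, of h "1::real"] by simp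
  then have "GDERIV f x :> adjoint f' 1"
    using f' unfolding gderiv_def by (metis (no_types, lifting) ext)
  then show ?thesis using grad_eqI by metis
qed

lemma L_smooth_GDERIV:
  fixes f :: "'a::euclidean_space \<Rightarrow> real"
  shows "L_smooth L f \<Longrightarrow> GDERIV f x :> grad f x"
  by (simp add: L_smooth_def differentiable_GDERIV_grad)

lemma L_smooth_norm_grad_diff:
  "L_smooth L f \<Longrightarrow> norm (grad f x - grad f y) \<le> L * norm (x - y)"
  unfolding L_smooth_def lipschitz_on_def by (simp add: dist_norm)

lemma L_smooth_nonneg: "L_smooth L f \<Longrightarrow> 0 \<le> L"
  unfolding L_smooth_def lipschitz_on_def by simp

lemma L_smooth_continuous_grad:
  "L_smooth L f \<Longrightarrow> continuous_on S (grad f)"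
  unfolding L_smooth_def
  by (metis continuous_on_subset lipschitz_on_continuous_on subset_UNIV)

lemma L_smooth_continuous:
  fixes f :: "'a::euclidean_space \<Rightarrow> real"
  shows "L_smooth L f \<Longrightarrow> continuous_on S f"
  unfolding L_smooth_def
  by (meson differentiable_imp_continuous_on differentiable_at_imp_differentiable_on)

lemma GDERIV_sum:
  assumes "\<And>i. i \<in> I \<Longrightarrow> GDERIV (f i) x :> D i"
  shows "GDERIV (\<lambda>x. \<Sum>i\<in>I. f i x) x :> (\<Sum>i\<in>I. D i)"
  using assms unfolding gderiv_def inner_sum_right by (rule has_derivative_sum)

lemma GDERIV_cmult:
  assumes "GDERIV f x :> D"
  shows "GDERIV (\<lambda>x. c * f x) x :> c *\<^sub>R D"
  using assms unfolding gderiv_def inner_scaleR_right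
  by (rule has_derivative_mult_right)

text \<open>The constants of smoothness and convexity survive taking arithmetic means, which is what
  both levels of the finite-sum objective are.\<close>

lemma grad_mean:
  fixes f :: "'i \<Rightarrow> 'a::euclidean_space \<Rightarrow> real"
  assumes "\<And>i. i \<in> I \<Longrightarrow> L_smooth L (f i)"
  shows "GDERIV (\<lambda>x. c * (\<Sum>i\<in>I. f i x)) x :> c *\<^sub>R (\<Sum>i\<in>I. grad (f i) x)"
  using assms by (intro GDERIV_cmult GDERIV_sum L_smooth_GDERIV)

lemma L_smooth_mean:
  fixes f :: "'i \<Rightarrow> 'a::euclidean_space \<Rightarrow> real"
  assumes I: "finite I" "I \<noteq> {}" and f: "\<And>i. i \<in> I \<Longrightarrow> L_smooth L (f i)"
  shows "L_smooth L (\<lambda>x. (1 / real (card I)) * (\<Sum>i\<in>I. f i x))"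
proof -
  let ?F = "\<lambda>x. (1 / real (card I)) * (\<Sum>i\<in>I. f i x)"
  have cI: "0 < real (card I)" using I by (simp add: card_gt_0_iff)
  have D: "GDERIV ?F x :> (1 / real (card I)) *\<^sub>R (\<Sum>i\<in>I. grad (f i) x)" for x
    by (rule grad_mean[OF f])
  have gr: "grad ?F x = (1 / real (card I)) *\<^sub>R (\<Sum>i\<in>I. grad (f i) x)" for x
    by (rule grad_eqI[OF D])
  have L0: "0 \<le> L" using I f L_smooth_nonneg by blast
  have "norm (grad ?F x - grad ?F y) \<le> L * norm (x - y)" for x y
  proof -
    have "norm (grad ?F x - grad ?F y)
        = (1 / real (card I)) * norm (\<Sum>i\<in>I. grad (f i) x - grad (f i) y)"
      by (simp only: gr scaleR_diff_right[symmetric] sum_subtractf norm_scaleR) simp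
    also have "\<dots> \<le> (1 / real (card I)) * (\<Sum>i\<in>I. L * norm (x - y))"
      by (intro mult_left_mono sum_norm_le L_smooth_norm_grad_diff f) auto
    also have "\<dots> = L * norm (x - y)" using cI by simp
    finally show ?thesis .
  qed
  moreover have "?F differentiable (at x)" for x
    using D[of x] unfolding gderiv_def differentiable_def by blast
  ultimately show ?thesis
    unfolding L_smooth_def lipschitz_on_def using L0 by (simp add: dist_norm)
qed

lemma convex_on_mean:
  assumes "finite I" "I \<noteq> {}" "\<And>i. i \<in> I \<Longrightarrow> convex_on S (f i)" "convex S"
  shows "convex_on S (\<lambda>x. (1 / real (card I)) * (\<Sum>i\<in>I. f i x))"
proof -
  have "convex_on S (\<lambda>x. \<Sum>i\<in>I. f i x)"
    using assms(1,3) by (induction I rule: finite_induct) (auto simp: convex_on_const assms(4))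
  then show ?thesis by (intro convex_on_cmul) auto
qed

lemma GDERIV_along_line:
  assumes "GDERIV f (x + \<tau> *\<^sub>R s) :> D"
  shows "((\<lambda>\<tau>. f (x + \<tau> *\<^sub>R s)) has_real_derivative D \<bullet> s) (at \<tau>)"
proof -
  have 1: "((\<lambda>\<tau>. x + \<tau> *\<^sub>R s) has_derivative (\<lambda>h. h *\<^sub>R s)) (at \<tau>)"
    by (auto intro!: derivative_eq_intros)
  have 2: "(f has_derivative (\<lambda>h. h \<bullet> D)) (at (x + \<tau> *\<^sub>R s))"
    using assms unfolding gderiv_def .
  have "(f \<circ> (\<lambda>\<tau>. x + \<tau> *\<^sub>R s) has_derivative (\<lambda>h. h \<bullet> D) \<circ> (\<lambda>h. h *\<^sub>R s)) (at \<tau>)"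
    using diff_chain_at[OF 1 2] .
  then show ?thesis
    by (simp add: has_field_derivative_def o_def inner_commute mult_commute_abs)
qed

lemma L_smooth_descent:
  fixes f :: "'a::euclidean_space \<Rightarrow> real"
  assumes f: "L_smooth L f"
  shows "f (x + s) \<le> f x + grad f x \<bullet> s + L / 2 * (norm s)\<^sup>2"
proof -
  \<comment> \<open>The claim compares the values at 1 and 0 of a function whose derivative is nonpositive.\<close>
  define h where "h = (\<lambda>\<tau>. f (x + \<tau> *\<^sub>R s) - \<tau> * (grad f x \<bullet> s) - L / 2 * \<tau>\<^sup>2 * (norm s)\<^sup>2)"
  have "h 1 \<le> h 0"
  proof (rule DERIV_nonpos_imp_nonincreasing[of 0 1 h])
    fix \<tau> :: real assume \<tau>: "0 \<le> \<tau>" "\<tau> \<le> 1"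
    have D: "(h has_real_derivative
        (grad f (x + \<tau> *\<^sub>R s) - grad f x) \<bullet> s - L * \<tau> * (norm s)\<^sup>2) (at \<tau>)"
      unfolding h_def
      by (auto intro!: derivative_eq_intros GDERIV_along_line[OF L_smooth_GDERIV[OF f]]
          simp: inner_diff_left)
    have "(grad f (x + \<tau> *\<^sub>R s) - grad f x) \<bullet> s \<le> norm (grad f (x + \<tau> *\<^sub>R s) - grad f x) * norm s"
      by (rule norm_cauchy_schwarz)
    also have "\<dots> \<le> L * norm (x + \<tau> *\<^sub>R s - x) * norm s"
      by (intro mult_right_mono L_smooth_norm_grad_diff f) simp
    also have "\<dots> = L * \<tau> * (norm s)\<^sup>2" using \<tau> by (simp add: power2_eq_square)
    finally show "\<exists>y. (h has_real_derivative y) (at \<tau>) \<and> y \<le> 0" using D by auto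
  qed simp
  then show ?thesis by (simp add: h_def)
qed

lemma convex_L_smooth_above_tangent:
  fixes f :: "'a::euclidean_space \<Rightarrow> real"
  assumes f: "L_smooth L f" and "convex_on UNIV f"
  shows "f x + grad f x \<bullet> (z - x) \<le> f z"
proof -
  let ?h = "\<lambda>\<tau>. f (x + \<tau> *\<^sub>R (z - x))"
  have "convex_on UNIV ?h"
  proof (rule convex_onI)
    fix t a b :: real assume "0 < t" "t < 1"
    have "x + ((1 - t) * a + t * b) *\<^sub>R (z - x)
        = (1 - t) *\<^sub>R (x + a *\<^sub>R (z - x)) + t *\<^sub>R (x + b *\<^sub>R (z - x))"
      by (simp add: algebra_simps)
    then show "?h ((1 - t) *\<^sub>R a + t *\<^sub>R b) \<le> (1 - t) * ?h a + t * ?h b"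
      using convex_onD[OF assms(2), of t "x + a *\<^sub>R (z - x)" "x + b *\<^sub>R (z - x)"] \<open>0 < t\<close> \<open>t < 1\<close>
      by simp
  qed simp
  moreover have "(?h has_real_derivative grad f x \<bullet> (z - x)) (at 0)"
    using GDERIV_along_line[of f x 0 "z - x"] L_smooth_GDERIV[OF f] by simp
  ultimately have "?h 1 - ?h 0 \<ge> (grad f x \<bullet> (z - x)) * (1 - 0)"
    by (intro convex_on_imp_above_tangent[where A = UNIV]) auto
  then show ?thesis by simp
qed

lemma L_smooth_norm_grad_sq_le:
  fixes f :: "'a::euclidean_space \<Rightarrow> real"
  assumes f: "L_smooth L f" and L: "0 < L" and min: "\<And>z. f xs \<le> f z"
  shows "(norm (grad f x))\<^sup>2 \<le> 2 * L * (f x - f xs)"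
proof -
  \<comment> \<open>A gradient step of length \<open>1 / L\<close> cannot go below the minimum.\<close>
  have "f xs \<le> f (x + (- (1 / L)) *\<^sub>R grad f x)" by (rule min)
  also have "\<dots> \<le> f x - (1 / L) * (norm (grad f x))\<^sup>2 + L / 2 * ((1 / L) * norm (grad f x))\<^sup>2"
    using L_smooth_descent[OF f, of x "(- (1 / L)) *\<^sub>R grad f x"] L
    by (simp add: power2_norm_eq_inner)
  also have "\<dots> = f x - (norm (grad f x))\<^sup>2 / (2 * L)"
    using L by (simp add: field_simps power2_eq_square)
  finally show ?thesis using L by (simp add: field_simps)
qed

lemma convex_gap_le_norm_grad:
  fixes f :: "'a::euclidean_space \<Rightarrow> real"
  assumes "L_smooth L f" "convex_on UNIV f" "x \<in> cball xs R"
  shows "f x - f xs \<le> R * norm (grad f x)"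
proof -
  have "f x - f xs \<le> - (grad f x \<bullet> (xs - x))"
    using convex_L_smooth_above_tangent[OF assms(1,2), of x xs] by simp
  also have "\<dots> \<le> norm (grad f x) * norm (xs - x)"
    using norm_cauchy_schwarz[of "- grad f x" "xs - x"] by simp
  also have "\<dots> \<le> norm (grad f x) * R"
    using assms(3) by (intro mult_left_mono) (auto simp: dist_norm)
  finally show ?thesis by (simp add: mult.commute)
qed

section \<open>One round of the server\<close>

lemma norm_add_sq_le: "(norm (a + b))\<^sup>2 \<le> 2 * (norm a)\<^sup>2 + 2 * (norm b)\<^sup>2"
  for a b :: "'a::real_inner"
proof -
  have "0 \<le> (norm (a - b))\<^sup>2" by simp
  then show ?thesis
    by (simp add: power2_norm_eq_inner inner_simps inner_commute)
qed

lemma norm_sum_sq_le: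
  fixes f :: "'i \<Rightarrow> 'a::real_normed_vector"
  shows "(norm (\<Sum>i\<in>I. f i))\<^sup>2 \<le> real (card I) * (\<Sum>i\<in>I. (norm (f i))\<^sup>2)"
proof -
  have "(norm (\<Sum>i\<in>I. f i))\<^sup>2 \<le> (\<Sum>i\<in>I. norm (f i))\<^sup>2"
    by (intro power_mono norm_sum) auto
  also have "\<dots> \<le> real (card I) * (\<Sum>i\<in>I. (norm (f i))\<^sup>2)"
    using Cauchy_Schwarz_ineq_sum[of "\<lambda>_. 1" "\<lambda>i. norm (f i)" I] by simp
  finally show ?thesis .
qed

text \<open>The only property of the step \<open>s\<close> that matters is that its surrogate value is at most that of
  the step \<open>- c *\<^sub>R h\<close>. The curvature excess \<open>\<Lambda> - L\<close> absorbs the error \<open>h - grad f x\<close> of the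
  surrogate slope by Young's inequality.\<close>

lemma surrogate_descent:
  fixes f :: "'a::euclidean_space \<Rightarrow> real"
  assumes f: "L_smooth L f" and \<Lambda>: "L < \<Lambda>" and c: "0 \<le> c" "\<Lambda> * c \<le> 1 / 2"
    and s: "h \<bullet> s + \<Lambda> / 2 * (norm s)\<^sup>2 \<le> h \<bullet> (- c *\<^sub>R h) + \<Lambda> / 2 * (norm (- c *\<^sub>R h))\<^sup>2"
  shows "f (x + s) \<le> f x - c / 4 * (norm (grad f x))\<^sup>2
           + (c + 1 / (\<Lambda> - L)) / 2 * (norm (h - grad f x))\<^sup>2"
proof -
  define e where "e = h - grad f x"
  have "0 \<le> (norm (e + (\<Lambda> - L) *\<^sub>R s))\<^sup>2 / (2 * (\<Lambda> - L))" using \<Lambda> by simp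
  also have "\<dots> = (norm e)\<^sup>2 / (2 * (\<Lambda> - L)) + e \<bullet> s + (\<Lambda> - L) / 2 * (norm s)\<^sup>2"
    unfolding power2_norm_eq_inner inner_add_left inner_add_right using \<Lambda>
    by (simp add: divide_simps inner_commute) (simp add: algebra_simps inner_commute)
  finally have young: "- (e \<bullet> s) - (\<Lambda> - L) / 2 * (norm s)\<^sup>2 \<le> (norm e)\<^sup>2 / (2 * (\<Lambda> - L))" by simp
  have "f (x + s) \<le> f x + grad f x \<bullet> s + L / 2 * (norm s)\<^sup>2"
    by (rule L_smooth_descent[OF f])
  also have "\<dots> = f x + (h \<bullet> s + \<Lambda> / 2 * (norm s)\<^sup>2) + (- (e \<bullet> s) - (\<Lambda> - L) / 2 * (norm s)\<^sup>2)"
    by (simp add: e_def inner_diff_left field_simps)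
  also have "\<dots> \<le> f x + (h \<bullet> (- c *\<^sub>R h) + \<Lambda> / 2 * (norm (- c *\<^sub>R h))\<^sup>2) + (norm e)\<^sup>2 / (2 * (\<Lambda> - L))"
    using s young by linarith
  also have "h \<bullet> (- c *\<^sub>R h) + \<Lambda> / 2 * (norm (- c *\<^sub>R h))\<^sup>2 = - (c * (norm h)\<^sup>2) * (1 - \<Lambda> * c / 2)"
    unfolding power2_norm_eq_inner by (simp add: algebra_simps)
  also have "\<dots> \<le> - (c * (norm h)\<^sup>2) * (1 / 2)"
    using c by (intro mult_left_mono_neg) auto
  also have "\<dots> \<le> - (c / 4 * (norm (grad f x))\<^sup>2) + c / 2 * (norm e)\<^sup>2"
  proof -
    have "(norm (grad f x))\<^sup>2 \<le> 2 * (norm h)\<^sup>2 + 2 * (norm e)\<^sup>2"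
      using norm_add_sq_le[of h "- e"] by (simp add: e_def norm_minus_commute)
    from mult_left_mono[OF this, of "c / 4"] c show ?thesis by (simp add: algebra_simps)
  qed
  finally show ?thesis by (simp add: e_def algebra_simps add_divide_distrib)
qed

text \<open>This is \<open>(1 - A * u) * (1 + A * u) \<le> 1\<close>, multiplied by \<open>u\<close>.\<close>

lemma sub_square_le_T_map:
  assumes "0 \<le> A" "0 \<le> u"
  shows "u - A * u\<^sup>2 \<le> T_map A u"
proof -
  have "0 < 1 + A * u" using assms by (simp add: add_pos_nonneg)
  moreover have "(u - A * u\<^sup>2) * (1 + A * u) = u - u * (A * u)\<^sup>2"
    by (simp add: power2_eq_square algebra_simps)
  moreover have "\<dots> \<le> u" using assms by simp
  ultimately show ?thesis unfolding T_map_def by (simp add: pos_le_divide_eq)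
qed

section \<open>Square-integrable random vectors\<close>

text \<open>Membership in the space of square-integrable functions, measurability included.\<close>

definition square_integrable :: "'w measure \<Rightarrow> ('w \<Rightarrow> 'a::euclidean_space) \<Rightarrow> bool" where
  "square_integrable M X \<longleftrightarrow> X \<in> borel_measurable M \<and> integrable M (\<lambda>\<omega>. (norm (X \<omega>))\<^sup>2)"

lemma square_integrable_norm_sq:
  "square_integrable M X \<Longrightarrow> integrable M (\<lambda>\<omega>. (norm (X \<omega>))\<^sup>2)"
  by (simp add: square_integrable_def)

lemma square_integrable_add:
  assumes "square_integrable M X" "square_integrable M Y"
  shows "square_integrable M (\<lambda>\<omega>. X \<omega> + Y \<omega>)"
proof -
  have [measurable]: "X \<in> borel_measurable M" "Y \<in> borel_measurable M"
    using assms by (auto simp: square_integrable_def)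
  have "integrable M (\<lambda>\<omega>. (norm (X \<omega> + Y \<omega>))\<^sup>2)"
  proof (rule Bochner_Integration.integrable_bound)
    show "integrable M (\<lambda>\<omega>. 2 * (norm (X \<omega>))\<^sup>2 + 2 * (norm (Y \<omega>))\<^sup>2)"
      using assms by (auto simp: square_integrable_def)
  qed (use norm_add_sq_le in auto)
  then show ?thesis by (simp add: square_integrable_def)
qed

lemma square_integrable_scaleR:
  "square_integrable M X \<Longrightarrow> square_integrable M (\<lambda>\<omega>. c *\<^sub>R X \<omega>)"
  by (auto simp: square_integrable_def power_mult_distrib)

lemma square_integrable_diff:
  assumes "square_integrable M X" "square_integrable M Y"
  shows "square_integrable M (\<lambda>\<omega>. X \<omega> - Y \<omega>)"
  using square_integrable_add[OF assms(1) square_integrable_scaleR[OF assms(2), of "-1"]] by simp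

lemma square_integrable_sum:
  assumes "\<And>i. i \<in> I \<Longrightarrow> square_integrable M (X i)"
  shows "square_integrable M (\<lambda>\<omega>. \<Sum>i\<in>I. X i \<omega>)"
  using assms
proof (induction I rule: infinite_finite_induct)
  case (insert i I)
  then show ?case by (simp add: square_integrable_add)
qed (auto simp: square_integrable_def)

lemma square_integrable_inner:
  assumes "square_integrable M X" "square_integrable M Y"
  shows "integrable M (\<lambda>\<omega>. X \<omega> \<bullet> Y \<omega>)"
proof -
  have "(\<lambda>\<omega>. X \<omega> \<bullet> Y \<omega>)
      = (\<lambda>\<omega>. ((norm (X \<omega> + Y \<omega>))\<^sup>2 - (norm (X \<omega>))\<^sup>2 - (norm (Y \<omega>))\<^sup>2) / 2)"
    by (auto simp: power2_norm_eq_inner inner_simps inner_commute)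
  then show ?thesis
    using square_integrable_add[OF assms] assms by (auto simp: square_integrable_def)
qed

lemma (in finite_measure) square_integrable_bounded:
  assumes [measurable]: "X \<in> borel_measurable M" and bd: "AE \<omega> in M. norm (X \<omega>) \<le> K"
  shows "square_integrable M X"
proof -
  have "AE \<omega> in M. norm ((norm (X \<omega>))\<^sup>2) \<le> K\<^sup>2"
    using bd by eventually_elim (simp add: power_mono)
  then have "integrable M (\<lambda>\<omega>. (norm (X \<omega>))\<^sup>2)"
    by (intro integrable_const_bound) auto
  then show ?thesis by (simp add: square_integrable_def)
qed

lemma square_integrable_component:
  fixes X :: "'w \<Rightarrow> real^'d"
  assumes "square_integrable M X"
  shows "square_integrable M (\<lambda>\<omega>. X \<omega> $ k)"
proof -
  have [measurable]: "X \<in> borel_measurable M"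
    using assms by (auto simp: square_integrable_def)
  have m: "(\<lambda>\<omega>. X \<omega> $ k) \<in> borel_measurable M"
    using borel_measurable_inner[of X M "\<lambda>_. axis k 1"] by (simp add: inner_axis)
  have "integrable M (\<lambda>\<omega>. (norm (X \<omega> $ k))\<^sup>2)"
  proof (rule Bochner_Integration.integrable_bound)
    show "integrable M (\<lambda>\<omega>. (norm (X \<omega>))\<^sup>2)"
      using assms by (auto simp: square_integrable_def)
    show "AE \<omega> in M. norm ((norm (X \<omega> $ k))\<^sup>2) \<le> norm ((norm (X \<omega>))\<^sup>2)"
      by (intro AE_I2) (metis component_le_norm_cart norm_ge_zero norm_power power_mono real_norm_def
          abs_norm_cancel)
  qed (use m in measurable)
  with m show ?thesis by (simp add: square_integrable_def)
qed

lemma (in finite_measure) square_integrable_imp_integrable: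
  fixes X :: "'a \<Rightarrow> real"
  assumes "square_integrable M X"
  shows "integrable M X"
  using square_integrable_inner[OF assms square_integrable_bounded[of "\<lambda>_. 1::real" 1]] by simp

lemma (in finite_measure) square_integrable_imp_integrable_component:
  fixes X :: "'a \<Rightarrow> real^'d"
  assumes "square_integrable M X"
  shows "integrable M (\<lambda>\<omega>. X \<omega> $ k)"
  by (rule square_integrable_imp_integrable[OF square_integrable_component[OF assms]])

lemma integral_norm_sq_sum_orthogonal:
  assumes "finite P" and X: "\<And>p. p \<in> P \<Longrightarrow> square_integrable M (X p)"
    and orth: "\<And>p q. p \<in> P \<Longrightarrow> q \<in> P \<Longrightarrow> p \<noteq> q \<Longrightarrow> (\<integral>\<omega>. X p \<omega> \<bullet> X q \<omega> \<partial>M) = 0"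
  shows "(\<integral>\<omega>. (norm (\<Sum>p\<in>P. X p \<omega>))\<^sup>2 \<partial>M) = (\<Sum>p\<in>P. \<integral>\<omega>. (norm (X p \<omega>))\<^sup>2 \<partial>M)"
proof -
  have "(\<integral>\<omega>. (norm (\<Sum>p\<in>P. X p \<omega>))\<^sup>2 \<partial>M) = (\<integral>\<omega>. (\<Sum>p\<in>P. \<Sum>q\<in>P. X p \<omega> \<bullet> X q \<omega>) \<partial>M)"
    by (simp add: power2_norm_eq_inner inner_sum_left inner_sum_right inner_commute)
  also have "\<dots> = (\<Sum>p\<in>P. \<Sum>q\<in>P. \<integral>\<omega>. X p \<omega> \<bullet> X q \<omega> \<partial>M)"
    by (simp add: Bochner_Integration.integral_sum square_integrable_inner X)
  also have "\<dots> = (\<Sum>p\<in>P. \<Sum>q\<in>P. if p = q then \<integral>\<omega>. (norm (X p \<omega>))\<^sup>2 \<partial>M else 0)"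
    by (intro sum.cong refl) (auto simp: orth power2_norm_eq_inner)
  also have "\<dots> = (\<Sum>p\<in>P. \<integral>\<omega>. (norm (X p \<omega>))\<^sup>2 \<partial>M)"
    using \<open>finite P\<close> by simp
  finally show ?thesis .
qed

section \<open>Conditional means and conditional independence\<close>

context prob_space
begin

lemma subalgebra_sigma_finite: "subalgebra M G \<Longrightarrow> sigma_finite_subalgebra M G"
  by (intro finite_measure_subalgebra_is_sigma_finite finite_measure_subalgebra.intro
      finite_measure_subalgebra_axioms.intro finite_measure_axioms)

lemma vec_cond_exp_zero_imp_orthogonal:
  fixes X Z :: "'a \<Rightarrow> real^'d"
  assumes G: "subalgebra M G" and X: "square_integrable M X" "X \<in> borel_measurable G"
    and Z: "square_integrable M Z"
    and zero: "\<And>k. AE \<omega> in M. real_cond_exp M G (\<lambda>\<omega>. Z \<omega> $ k) \<omega> = 0"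
  shows "(\<integral>\<omega>. X \<omega> \<bullet> Z \<omega> \<partial>M) = 0"
proof -
  interpret G: sigma_finite_subalgebra M G by (rule subalgebra_sigma_finite[OF G])
  have int: "integrable M (\<lambda>\<omega>. X \<omega> $ k * Z \<omega> $ k)" for k
    using square_integrable_inner[OF square_integrable_component[OF X(1), of k]
        square_integrable_component[OF Z, of k]] by simp
  have Xk: "(\<lambda>\<omega>. X \<omega> $ k) \<in> borel_measurable G" for k
    using borel_measurable_inner[OF X(2), of "\<lambda>_. axis k 1"] by (simp add: inner_axis)
  have Zk: "(\<lambda>\<omega>. Z \<omega> $ k) \<in> borel_measurable M" for k
    using square_integrable_component[OF Z, of k] by (simp add: square_integrable_def)
  have "(\<integral>\<omega>. X \<omega> $ k * Z \<omega> $ k \<partial>M) = 0" for k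
  proof -
    have "(\<integral>\<omega>. X \<omega> $ k * Z \<omega> $ k \<partial>M)
        = (\<integral>\<omega>. X \<omega> $ k * real_cond_exp M G (\<lambda>\<omega>. Z \<omega> $ k) \<omega> \<partial>M)"
      by (rule G.real_cond_exp_intg(2)[OF int Xk Zk, symmetric])
    also have "\<dots> = 0"
      using zero[of k] by (intro integral_eq_zero_AE) auto
    finally show ?thesis .
  qed
  then show ?thesis
    unfolding inner_vec_def inner_real_def
    by (subst Bochner_Integration.integral_sum[OF int]) simp
qed

text \<open>A signed version of uniqueness of measures on an intersection-stable generator.\<close>

lemma set_integral_zero_on_generated:
  fixes f :: "'a \<Rightarrow> real"
  assumes f: "integrable M f" and E: "Int_stable E" "E \<subseteq> sets M"
    and total: "(\<integral>\<omega>. f \<omega> \<partial>M) = 0"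
    and zero: "\<And>C. C \<in> E \<Longrightarrow> (LINT \<omega>:C|M. f \<omega>) = 0"
    and D: "D \<in> sigma_sets (space M) E"
  shows "(LINT \<omega>:D|M. f \<omega>) = 0"
proof -
  have sub: "sigma_sets (space M) E \<subseteq> sets M"
    using E(2) by (rule sets.sigma_sets_subset)
  have set_int: "set_integrable M A f" if "A \<in> sets M" for A
    unfolding set_integrable_def by (rule integrable_mult_indicator[OF that f])
  have "E \<subseteq> Pow (space M)" using E(2) sets.sets_into_space by blast
  from E(1) this D show ?thesis
  proof (induction rule: sigma_sets_induct_disjoint)
    case (basic A)
    then show ?case by (rule zero)
  next
    case empty
    then show ?case by (simp add: set_lebesgue_integral_def)
  next
    case (compl A)
    then have A: "A \<in> sets M" using sub by blast
    have "(LINT \<omega>:(space M - A)|M. f \<omega>) + (LINT \<omega>:A|M. f \<omega>)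
        = (LINT \<omega>:((space M - A) \<union> A)|M. f \<omega>)"
      using A by (intro set_integral_Un[symmetric] set_int) auto
    also have "(space M - A) \<union> A = space M" using A sets.sets_into_space by blast
    also have "(LINT \<omega>:space M|M. f \<omega>) = 0"
      using total set_integral_space[OF f] by simp
    finally show ?case using compl by simp
  next
    case (union A)
    then have A: "A i \<in> sets M" for i using sub by blast
    have "(LINT \<omega>:(\<Union>i. A i)|M. f \<omega>) = (\<Sum>i. (LINT \<omega>:(A i)|M. f \<omega>))"
      using union(1) A
      by (intro lebesgue_integral_countable_add set_int) (auto simp: disjoint_family_on_def)
    then show ?case using union by simp
  qed
qed

lemma set_integral_zero_on_join:
  fixes f :: "'a \<Rightarrow> real"
  assumes f: "integrable M f" and F: "subalgebra M F"
    and E: "Int_stable E" "space M \<in> E" "E \<subseteq> sets M"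
    and G: "sets G = sigma_sets (space M) {A \<inter> C |A C. A \<in> sets F \<and> C \<in> E}"
    and zero: "\<And>A C. A \<in> sets F \<Longrightarrow> C \<in> E \<Longrightarrow> (\<integral>\<omega>. indicator A \<omega> * (indicator C \<omega> * f \<omega>) \<partial>M) = 0"
    and D: "D \<in> sets G"
  shows "(LINT \<omega>:D|M. f \<omega>) = 0"
proof (rule set_integral_zero_on_generated[OF f])
  let ?E = "{A \<inter> C |A C. A \<in> sets F \<and> C \<in> E}"
  have spF: "space M \<in> sets F" using F by (metis sets.top subalgebra_def)
  show "Int_stable ?E"
  proof (rule Int_stableI)
    fix U V assume "U \<in> ?E" "V \<in> ?E"
    then obtain A C A' C' where "U = A \<inter> C" "V = A' \<inter> C'" "A \<in> sets F" "A' \<in> sets F" "C \<in> E" "C' \<in> E"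
      by blast
    moreover from this have "U \<inter> V = (A \<inter> A') \<inter> (C \<inter> C')" "C \<inter> C' \<in> E"
      using E(1) by (auto simp: Int_stable_def)
    ultimately show "U \<inter> V \<in> ?E" by blast
  qed
  show "?E \<subseteq> sets M" using F E(3) by (auto simp: subalgebra_def)
  have eq: "(LINT \<omega>:A \<inter> C|M. f \<omega>) = (\<integral>\<omega>. indicator A \<omega> * (indicator C \<omega> * f \<omega>) \<partial>M)" for A C
    by (simp add: set_lebesgue_integral_def indicator_inter_arith mult.assoc)
  show "(LINT \<omega>:U|M. f \<omega>) = 0" if "U \<in> ?E" for U
    using that eq zero by auto
  from zero[OF spF E(2)] eq[of "space M" "space M"] set_integral_space[OF f]
  show "(\<integral>\<omega>. f \<omega> \<partial>M) = 0" by simp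
  show "D \<in> sigma_sets (space M) ?E" using D G by simp
qed

text \<open>If the information \<open>E1\<close> and \<open>E2\<close> is conditionally independent given \<open>F\<close>, then revealing
  \<open>E2\<close> on top of \<open>F\<close> does not change the conditional mean of a quantity determined by \<open>F\<close> and
  \<open>E1\<close>. The proof passes through the dual statement that the conditional probability of an event of
  \<open>E2\<close> is the same given \<open>F\<close> and given \<open>F\<close> with \<open>E1\<close>.\<close>

lemma cond_indep_cond_exp_zero:
  fixes X :: "'a \<Rightarrow> real"
  assumes F: "subalgebra M F" and G1: "subalgebra M G1" and G2: "subalgebra M G2"
    and E1: "Int_stable E1" "space M \<in> E1" "E1 \<subseteq> sets M"
    and E2: "Int_stable E2" "space M \<in> E2" "E2 \<subseteq> sets M"
    and setsG1: "sets G1 = sigma_sets (space M) {A \<inter> C |A C. A \<in> sets F \<and> C \<in> E1}"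
    and setsG2: "sets G2 = sigma_sets (space M) {A \<inter> C |A C. A \<in> sets F \<and> C \<in> E2}"
    and indep: "\<And>C1 C2. C1 \<in> E1 \<Longrightarrow> C2 \<in> E2 \<Longrightarrow> AE \<omega> in M.
        real_cond_exp M F (indicat_real (C1 \<inter> C2)) \<omega>
        = real_cond_exp M F (indicat_real C1) \<omega> * real_cond_exp M F (indicat_real C2) \<omega>"
    and X: "integrable M X" "X \<in> borel_measurable G1"
    and X0: "AE \<omega> in M. real_cond_exp M F X \<omega> = 0"
  shows "AE \<omega> in M. real_cond_exp M G2 X \<omega> = 0"
proof -
  interpret F: sigma_finite_subalgebra M F by (rule subalgebra_sigma_finite[OF F])
  interpret G1: sigma_finite_subalgebra M G1 by (rule subalgebra_sigma_finite[OF G1])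
  interpret G2: sigma_finite_subalgebra M G2 by (rule subalgebra_sigma_finite[OF G2])
  have FM: "A \<in> sets M" if "A \<in> sets F" for A
    using F that by (auto simp: subalgebra_def)
  have FG1: "subalgebra G1 F"
  proof -
    have "A \<in> sets G1" if "A \<in> sets F" for A
    proof -
      have "A = A \<inter> space M" using FM[OF that] sets.sets_into_space by blast
      then show ?thesis using that E1(2) unfolding setsG1 by blast
    qed
    then show ?thesis using F G1 by (auto simp: subalgebra_def)
  qed
  have ind: "integrable M (indicat_real C)" if "C \<in> sets M" for C
    using integrable_real_indicator[OF that] by (simp add: less_top[symmetric])
  have key: "(\<integral>\<omega>. indicator A \<omega> * (indicator C2 \<omega> * X \<omega>) \<partial>M) = 0"
    if A: "A \<in> sets F" and C2: "C2 \<in> E2" for A C2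
  proof -
    define p where "p = real_cond_exp M F (indicat_real C2)"
    have C2M: "C2 \<in> sets M" using C2 E2(3) by blast
    have pF: "p \<in> borel_measurable F" unfolding p_def by simp
    have pM: "p \<in> borel_measurable M" by (rule measurable_from_subalg[OF F pF])
    have pG1: "p \<in> borel_measurable G1" by (rule measurable_from_subalg[OF FG1 pF])
    have pint: "integrable M p" unfolding p_def by (intro F.real_cond_exp_int ind C2M)
    have AF: "indicat_real A' \<in> borel_measurable F" if "A' \<in> sets F" for A'
      using that by simp
    \<comment> \<open>The dual statement: \<open>E1\<close> carries no information on \<open>C2\<close> beyond \<open>F\<close>.\<close>
    have "AE \<omega> in M. real_cond_exp M G1 (indicat_real C2) \<omega> = p \<omega>"
    proof (rule G1.real_cond_exp_charact[OF _ ind[OF C2M] pint pG1])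
      fix D assume D: "D \<in> sets G1"
      then have DM: "D \<in> sets M" using G1 by (auto simp: subalgebra_def)
      have "(LINT \<omega>:D|M. indicat_real C2 \<omega> - p \<omega>) = 0"
      proof (rule set_integral_zero_on_join[OF _ F E1 setsG1 _ D])
        show "integrable M (\<lambda>\<omega>. indicat_real C2 \<omega> - p \<omega>)"
          by (intro Bochner_Integration.integrable_diff ind C2M pint)
        fix A' C1 assume A': "A' \<in> sets F" and C1: "C1 \<in> E1"
        have C1M: "C1 \<in> sets M" using C1 E1(3) by blast
        have A'M: "A' \<in> sets M" using FM[OF A'] .
        have C12: "C1 \<inter> C2 \<in> sets M" using C1M C2M by (rule sets.Int)
        have i1: "integrable M (\<lambda>\<omega>. indicat_real A' \<omega> * indicat_real (C1 \<inter> C2) \<omega>)"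
          using integrable_mult_indicator[OF A'M ind[OF C12]] by simp
        have i2: "integrable M (\<lambda>\<omega>. (indicat_real A' \<omega> * p \<omega>) * indicat_real C1 \<omega>)"
          using integrable_mult_indicator[OF C1M integrable_mult_indicator[OF A'M pint]]
          by (simp add: mult.commute mult.left_commute)
        have A'pF: "(\<lambda>\<omega>. indicat_real A' \<omega> * p \<omega>) \<in> borel_measurable F"
          using AF[OF A'] pF by (rule borel_measurable_times)
        have "(\<integral>\<omega>. indicator A' \<omega> * indicat_real (C1 \<inter> C2) \<omega> \<partial>M)
            = (\<integral>\<omega>. indicator A' \<omega> * real_cond_exp M F (indicat_real (C1 \<inter> C2)) \<omega> \<partial>M)"
          by (rule F.real_cond_exp_intg(2)[OF i1 AF[OF A'] borel_measurable_indicator[OF C12], symmetric])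
        also have "\<dots> = (\<integral>\<omega>. (indicator A' \<omega> * p \<omega>) * real_cond_exp M F (indicat_real C1) \<omega> \<partial>M)"
        proof (rule integral_cong_AE)
          show "AE \<omega> in M. indicator A' \<omega> * real_cond_exp M F (indicat_real (C1 \<inter> C2)) \<omega>
              = (indicator A' \<omega> * p \<omega>) * real_cond_exp M F (indicat_real C1) \<omega>"
            using indep[OF C1 C2] unfolding p_def[symmetric] by eventually_elim simp
        qed (intro borel_measurable_times borel_measurable_cond_exp2 pM
            borel_measurable_indicator A'M)+
        also have "\<dots> = (\<integral>\<omega>. (indicator A' \<omega> * p \<omega>) * indicat_real C1 \<omega> \<partial>M)"
          by (rule F.real_cond_exp_intg(2)[OF i2 A'pF borel_measurable_indicator[OF C1M]])
        finally have "(\<integral>\<omega>. indicator A' \<omega> * indicat_real (C1 \<inter> C2) \<omega>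
            - (indicator A' \<omega> * p \<omega>) * indicat_real C1 \<omega> \<partial>M) = 0"
          by (subst Bochner_Integration.integral_diff[OF i1 i2]) simp
        then show "(\<integral>\<omega>. indicator A' \<omega> * (indicator C1 \<omega> * (indicat_real C2 \<omega> - p \<omega>)) \<partial>M) = 0"
          by (simp add: indicator_inter_arith algebra_simps)
      qed
      then show "(LINT \<omega>:D|M. indicat_real C2 \<omega>) = (LINT \<omega>:D|M. p \<omega>)"
        using ind[OF C2M] pint integrable_mult_indicator[OF DM ind[OF C2M]]
          integrable_mult_indicator[OF DM pint]
        by (simp add: set_lebesgue_integral_def algebra_simps)
    qed
    note pG = this
    have AM: "A \<in> sets M" using FM[OF A] .
    have XM: "X \<in> borel_measurable M" by (rule measurable_from_subalg[OF G1 X(2)])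
    have AX: "(\<lambda>\<omega>. indicat_real A \<omega> * X \<omega>) \<in> borel_measurable G1"
      using measurable_from_subalg[OF FG1 AF[OF A]] X(2) by (rule borel_measurable_times)
    have i3: "integrable M (\<lambda>\<omega>. (indicat_real A \<omega> * X \<omega>) * indicat_real C2 \<omega>)"
      using integrable_mult_indicator[OF C2M integrable_mult_indicator[OF AM X(1)]]
      by (simp add: mult_ac)
    have C2m: "indicat_real C2 \<in> borel_measurable M" using C2M by simp
    have ae: "AE \<omega> in M. (indicat_real A \<omega> * X \<omega>) * real_cond_exp M G1 (indicat_real C2) \<omega>
        = (indicat_real A \<omega> * p \<omega>) * X \<omega>"
      using pG by eventually_elim simp
    \<comment> \<open>Integrability is inherited from the conditional expectation; no bound on \<open>p\<close> is needed.\<close>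
    have i4: "integrable M (\<lambda>\<omega>. (indicat_real A \<omega> * p \<omega>) * X \<omega>)"
      using G1.real_cond_exp_intg(1)[OF i3 AX C2m]
      by (rule integrable_cong_AE_imp[OF _ _ ae])
        (intro borel_measurable_times pM XM borel_measurable_indicator AM)
    have ApF: "(\<lambda>\<omega>. indicat_real A \<omega> * p \<omega>) \<in> borel_measurable F"
      using AF[OF A] pF by (rule borel_measurable_times)
    have "(\<integral>\<omega>. indicator A \<omega> * (indicator C2 \<omega> * X \<omega>) \<partial>M)
        = (\<integral>\<omega>. (indicator A \<omega> * X \<omega>) * indicat_real C2 \<omega> \<partial>M)"
      by (simp add: mult_ac)
    also have "\<dots> = (\<integral>\<omega>. (indicator A \<omega> * X \<omega>) * real_cond_exp M G1 (indicat_real C2) \<omega> \<partial>M)"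
      by (rule G1.real_cond_exp_intg(2)[OF i3 AX C2m, symmetric])
    also have "\<dots> = (\<integral>\<omega>. (indicator A \<omega> * p \<omega>) * X \<omega> \<partial>M)"
      by (rule integral_cong_AE[OF _ _ ae];
          intro borel_measurable_times borel_measurable_cond_exp2 pM XM
            borel_measurable_indicator AM)
    also have "\<dots> = (\<integral>\<omega>. (indicator A \<omega> * p \<omega>) * real_cond_exp M F X \<omega> \<partial>M)"
      by (rule F.real_cond_exp_intg(2)[OF i4 ApF XM, symmetric])
    also have "\<dots> = 0"
      using X0 by (intro integral_eq_zero_AE) auto
    finally show ?thesis .
  qed
  show ?thesis
  proof (rule G2.real_cond_exp_charact)
    fix D assume "D \<in> sets G2"
    from set_integral_zero_on_join[OF X(1) F E2 setsG2 key this]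
    show "(LINT \<omega>:D|M. X \<omega>) = (LINT \<omega>:D|M. 0)" by (simp add: set_lebesgue_integral_def)
  qed (use X in auto)
qed

end

section \<open>The filtrations\<close>

context hom_post_local
begin

text \<open>The information before round \<open>t\<close>, and that of node \<open>i\<close> before its local step \<open>l\<close>.\<close>

abbreviation \<F> :: "nat \<Rightarrow> 'w measure" where
  "\<F> t \<equiv> round_hist M H B (x 0) t"

abbreviation \<G> :: "'n \<Rightarrow> nat \<Rightarrow> nat \<Rightarrow> 'w measure" where
  "\<G> i t l \<equiv> local_hist M H B (x 0) i t l"

lemma vimage_algebra_into_space: "A \<in> sets (vimage_algebra \<Omega> f N) \<Longrightarrow> A \<subseteq> \<Omega>"
  using sets.sets_into_space by fastforce

lemma sets_round_hist:
  "sets (\<F> t) = sigma_sets (space M)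
     (sets (vimage_algebra (space M) (x 0) borel) \<union>
      (\<Union>s<t. \<Union>i. \<Union>l<H i. sets (vimage_algebra (space M) (B i s l) (count_space UNIV))))"
  unfolding round_hist_def
  by (rule sets_measure_of) (auto dest!: vimage_algebra_into_space)

lemma space_round_hist [simp]: "space (\<F> t) = space M"
  unfolding round_hist_def
  by (rule space_measure_of) (auto dest!: vimage_algebra_into_space)

lemma sets_local_hist:
  "sets (\<G> i t l) = sigma_sets (space M)
     (sets (\<F> t) \<union> (\<Union>k<l. sets (vimage_algebra (space M) (B i t k) (count_space UNIV))))"
  unfolding local_hist_def
  by (rule sets_measure_of)
    (use sets.space_closed[of "\<F> t"] in \<open>auto dest!: vimage_algebra_into_space\<close>)

lemma space_local_hist [simp]: "space (\<G> i t l) = space M"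
  unfolding local_hist_def
  by (rule space_measure_of)
    (use sets.space_closed[of "\<F> t"] in \<open>auto dest!: vimage_algebra_into_space\<close>)

lemma sets_vimage_subset:
  assumes "f \<in> measurable M N"
  shows "sets (vimage_algebra (space M) f N) \<subseteq> sets M"
  by (subst sets_vimage_algebra2) (use assms in \<open>auto dest: measurable_space measurable_sets\<close>)

lemma subalgebra_round_hist: "subalgebra M (\<F> t)"
proof -
  have "sets (\<F> t) \<subseteq> sets M"
    unfolding sets_round_hist
    by (intro sets.sigma_sets_subset Un_least UN_least sets_vimage_subset init_measurable
        batch_measurable) simp
  then show ?thesis by (simp add: subalgebra_def)
qed

lemma subalgebra_local_hist:
  assumes "l \<le> H i"
  shows "subalgebra M (\<G> i t l)"
proof -
  have "sets (vimage_algebra (space M) (B i t k) (count_space UNIV)) \<subseteq> sets M" if "k < l" for k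
    using that assms by (intro sets_vimage_subset batch_measurable) simp
  then have "sets (\<G> i t l) \<subseteq> sets M"
    unfolding sets_local_hist using subalgebra_round_hist[of t]
    by (intro sets.sigma_sets_subset) (auto simp: subalgebra_def)
  then show ?thesis by (simp add: subalgebra_def)
qed

lemma subalgebra_local_hist_mono:
  assumes "l \<le> l'"
  shows "subalgebra (\<G> i t l') (\<G> i t l)"
proof -
  have "sets (\<G> i t l) \<subseteq> sets (\<G> i t l')"
    unfolding sets_local_hist by (rule sigma_sets_mono') (use assms in force)
  then show ?thesis by (simp add: subalgebra_def)
qed

lemma subalgebra_local_round: "subalgebra (\<G> i t l) (\<F> t)"
  unfolding subalgebra_def sets_local_hist by auto

lemma subalgebra_round_local:
  assumes "l \<le> H i"
  shows "subalgebra (\<F> (Suc t)) (\<G> i t l)"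
proof -
  have "sets (\<F> t) \<subseteq> sets (\<F> (Suc t))"
    unfolding sets_round_hist by (rule sigma_sets_mono') (auto simp: lessThan_Suc)
  moreover have "sets (vimage_algebra (space M) (B i t k) (count_space UNIV)) \<subseteq> sets (\<F> (Suc t))"
    if "k < l" for k
    unfolding sets_round_hist using that assms by (auto intro!: sigma_sets.Basic bexI[of _ k])
  ultimately have "sets (\<G> i t l) \<subseteq> sets (\<F> (Suc t))"
    unfolding sets_local_hist
    unfolding space_round_hist[of "Suc t", symmetric]
    by (intro sets.sigma_sets_subset) (auto simp del: space_round_hist)
  then show ?thesis by (simp add: subalgebra_def)
qed

text \<open>Before the first local step all nodes share the history of the round.\<close>

lemma local_hist_0: "\<G> i t 0 = \<G> j t 0"
  by (simp add: local_hist_def)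

lemma iterate_measurable_local:
  assumes x: "x t \<in> borel_measurable (\<F> t)"
  shows "l \<le> H i \<Longrightarrow> y i t l \<in> borel_measurable (\<G> i t l)"
proof (induction l)
  case 0
  have "x t \<in> borel_measurable (\<G> i t 0)"
    by (rule measurable_from_subalg[OF subalgebra_local_round x])
  then show ?case by (subst measurable_cong[of _ _ "x t"]) (simp_all add: local_init)
next
  case (Suc l)
  then have l: "l < H i" by simp
  have "y i t l \<in> borel_measurable (\<G> i t (Suc l))"
    using Suc by (intro measurable_from_subalg[OF subalgebra_local_hist_mono[of l "Suc l"]]) auto
  with grad_measurable[OF l, of t]
  have "(\<lambda>\<omega>. y i t l \<omega> - step_size L H (\<theta> t) i *\<^sub>R g i t l \<omega>) \<in> borel_measurable (\<G> i t (Suc l))"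
    by measurable
  then show ?case
    by (subst measurable_cong) (auto simp: local_step[OF l])
qed

lemma state_measurable_round: "x t \<in> borel_measurable (\<F> t)"
proof (induction t)
  case 0
  have "x 0 \<in> measurable (vimage_algebra (space M) (x 0) borel) borel"
    by (rule measurable_vimage_algebra1) simp
  moreover have "subalgebra (\<F> 0) (vimage_algebra (space M) (x 0) borel)"
    unfolding subalgebra_def sets_round_hist by auto
  ultimately show ?case by (rule measurable_from_subalg[rotated])
next
  case (Suc t)
  have [measurable]: "y i t (H i) \<in> borel_measurable (\<F> (Suc t))" for i
    by (rule measurable_from_subalg[OF subalgebra_round_local iterate_measurable_local[OF Suc]]) auto
  have [measurable]: "x t \<in> borel_measurable (\<F> (Suc t))"
    by (rule measurable_from_subalg[OF subalgebra_round_local[of 0]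
          measurable_from_subalg[OF subalgebra_local_round Suc]]) simp
  have [measurable]: "(\<lambda>\<omega>. w t \<omega> $ i) \<in> borel_measurable (\<F> (Suc t))" for i
    using borel_measurable_inner[OF weights_measurable[of t], of "\<lambda>_. axis i 1"]
    by (simp add: inner_axis)
  have "(\<lambda>\<omega>. x t \<omega> + (\<Sum>i\<in>UNIV. w t \<omega> $ i *\<^sub>R (y i t (H i) \<omega> - x t \<omega>))) \<in> borel_measurable (\<F> (Suc t))"
    by measurable
  then show ?case by (subst measurable_cong) (auto simp: server_step)
qed

lemmas iterate_measurable = iterate_measurable_local[OF state_measurable_round]

text \<open>The events that the first \<open>l\<close> minibatches of node \<open>i\<close> in round \<open>t\<close> lie in a given product
  set. They are stable under intersection and, together with the history of the round, generate
  \<open>\<G> i t l\<close>.\<close>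

definition batch_events :: "'n \<Rightarrow> nat \<Rightarrow> nat \<Rightarrow> 'w set set" where
  "batch_events i t l = range (\<lambda>S. {\<omega> \<in> space M. \<forall>k<l. B i t k \<omega> \<in> S k})"

lemma batch_events_Int_stable: "Int_stable (batch_events i t l)"
proof (rule Int_stableI)
  fix U V assume "U \<in> batch_events i t l" "V \<in> batch_events i t l"
  then obtain S S' where "U = {\<omega> \<in> space M. \<forall>k<l. B i t k \<omega> \<in> S k}"
    "V = {\<omega> \<in> space M. \<forall>k<l. B i t k \<omega> \<in> S' k}"
    unfolding batch_events_def by blast
  then have "U \<inter> V = {\<omega> \<in> space M. \<forall>k<l. B i t k \<omega> \<in> (S k \<inter> S' k)}" by auto
  then show "U \<inter> V \<in> batch_events i t l"
    unfolding batch_events_def by (rule range_eqI[of _ _ "\<lambda>k. S k \<inter> S' k"])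
qed

lemma space_in_batch_events: "space M \<in> batch_events i t l"
  unfolding batch_events_def by (rule range_eqI[of _ _ "\<lambda>_. UNIV"]) simp

lemma batch_measurable_local: "k < l \<Longrightarrow> B i t k \<in> measurable (\<G> i t l) (count_space UNIV)"
proof -
  assume k: "k < l"
  have "B i t k \<in> measurable (vimage_algebra (space M) (B i t k) (count_space UNIV)) (count_space UNIV)"
    by (rule measurable_vimage_algebra1) simp
  moreover have "subalgebra (\<G> i t l) (vimage_algebra (space M) (B i t k) (count_space UNIV))"
    unfolding subalgebra_def sets_local_hist using k by auto
  ultimately show ?thesis by (rule measurable_from_subalg[rotated])
qed

lemma batch_events_subset_local: "batch_events i t l \<subseteq> sets (\<G> i t l)"
proof
  fix U assume "U \<in> batch_events i t l"
  then obtain S where "U = {\<omega> \<in> space M. \<forall>k<l. B i t k \<omega> \<in> S k}"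
    unfolding batch_events_def by blast
  then have U: "U = {\<omega> \<in> space (\<G> i t l). \<forall>k\<in>{..<l}. B i t k \<omega> \<in> S k}" by auto
  have "{\<omega> \<in> space (\<G> i t l). B i t k \<omega> \<in> S k} \<in> sets (\<G> i t l)" if "k < l" for k
  proof -
    have "{\<omega> \<in> space (\<G> i t l). B i t k \<omega> \<in> S k} = B i t k -` S k \<inter> space (\<G> i t l)" by auto
    then show ?thesis
      using measurable_sets[OF batch_measurable_local[OF that, of i t], of "S k"] by simp
  qed
  then show "U \<in> sets (\<G> i t l)"
    unfolding U by (intro sets.sets_Collect_finite_All) simp_all
qed

lemma sets_local_hist_join:
  "sets (\<G> i t l) = sigma_sets (space M) {A \<inter> C |A C. A \<in> sets (\<G> i t 0) \<and> C \<in> batch_events i t l}"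
  (is "_ = sigma_sets _ ?E")
proof (rule antisym)
  have EI: "A \<inter> C \<in> ?E" if "A \<in> sets (\<G> i t 0)" "C \<in> batch_events i t l" for A C
    using that by blast
  have sp: "space M \<in> sets (\<G> i t 0)" by (metis sets.top space_local_hist)
  have 1: "sets (\<F> t) \<subseteq> ?E"
  proof
    fix A assume A: "A \<in> sets (\<F> t)"
    then have "A \<inter> space M = A" using sets.sets_into_space[OF A] by auto
    moreover have "A \<in> sets (\<G> i t 0)"
      using A subalgebra_local_round[of i t 0] by (simp add: subalgebra_def subset_iff)
    ultimately show "A \<in> ?E" using EI[OF _ space_in_batch_events, of A] by simp
  qed
  have 2: "sets (vimage_algebra (space M) (B i t k) (count_space UNIV)) \<subseteq> ?E" if k: "k < l" for k
  proof
    fix A assume "A \<in> sets (vimage_algebra (space M) (B i t k) (count_space UNIV))"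
    then obtain S where A: "A = B i t k -` S \<inter> space M"
      using sets_vimage_algebra2[of "B i t k" "space M" "count_space UNIV"] by auto
    define C where "C = {\<omega> \<in> space M. \<forall>k'<l. B i t k' \<omega> \<in> (if k' = k then S else UNIV)}"
    have "(\<forall>k'<l. B i t k' \<omega> \<in> (if k' = k then S else UNIV)) \<longleftrightarrow> B i t k \<omega> \<in> S" for \<omega>
      using k by (metis UNIV_I)
    then have "A = space M \<inter> C" unfolding A C_def by blast
    moreover have "C \<in> batch_events i t l"
      unfolding batch_events_def C_def by (rule range_eqI[OF refl])
    ultimately show "A \<in> ?E" using EI[OF sp, of C] by simp
  qed
  show "sets (\<G> i t l) \<subseteq> sigma_sets (space M) ?E"
    unfolding sets_local_hist[of i t l] by (intro sigma_sets_mono' Un_least UN_least 1 2) simp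
  have "?E \<subseteq> sets (\<G> i t l)"
  proof
    fix U assume "U \<in> ?E"
    then obtain A C where "U = A \<inter> C" "A \<in> sets (\<G> i t 0)" "C \<in> batch_events i t l" by blast
    moreover from this have "A \<in> sets (\<G> i t l)" "C \<in> sets (\<G> i t l)"
      using subalgebra_local_hist_mono[of 0 l i t] batch_events_subset_local[of i t l]
      by (simp_all add: subalgebra_def subset_iff)
    ultimately show "U \<in> sets (\<G> i t l)" by (simp add: sets.Int)
  qed
  then show "sigma_sets (space M) ?E \<subseteq> sets (\<G> i t l)"
    using sets.sigma_sets_subset[of ?E "\<G> i t l"] by simp
qed

text \<open>Product sets turn the conditional independence of the single minibatches into that of the
  minibatch histories of two nodes.\<close>

lemma batch_events_cond_indep:
  assumes ij: "i \<noteq> j" and l: "l \<le> H i" "k \<le> H j"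
    and C: "C1 \<in> batch_events i t l" "C2 \<in> batch_events j t k"
  shows "AE \<omega> in M. real_cond_exp M (\<G> i t 0) (indicat_real (C1 \<inter> C2)) \<omega>
      = real_cond_exp M (\<G> i t 0) (indicat_real C1) \<omega> * real_cond_exp M (\<G> i t 0) (indicat_real C2) \<omega>"
proof -
  obtain S1 S2 where C1: "C1 = {\<omega> \<in> space M. \<forall>k'<l. B i t k' \<omega> \<in> S1 k'}"
    and C2: "C2 = {\<omega> \<in> space M. \<forall>k'<k. B j t k' \<omega> \<in> S2 k'}"
    using C unfolding batch_events_def by auto
  define S where "S = (\<lambda>(i', k'). if i' = i then S1 k' else S2 k')"
  define X where "X = (\<lambda>(i', k'). B i' t k')"
  let ?J1 = "{i} \<times> {..<l}" and ?J2 = "{j} \<times> {..<k}"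
  let ?p = "\<lambda>J \<omega>. real_cond_exp M (\<G> i t 0) (indicat_real {\<omega>' \<in> space M. \<forall>q\<in>J. X q \<omega>' \<in> S q}) \<omega>"
  let ?r = "\<lambda>J \<omega>. \<Prod>q\<in>J. real_cond_exp M (\<G> i t 0) (indicat_real {\<omega>' \<in> space M. X q \<omega>' \<in> S q}) \<omega>"
  have J: "?J1 \<subseteq> (SIGMA j:UNIV. {..<H j})" "?J2 \<subseteq> (SIGMA j:UNIV. {..<H j})"
    using l by auto
  have "0 < H i" using H_pos[of i] by simp
  from batches_cond_indep[OF this, of t]
  have ci: "AE \<omega> in M. ?p J \<omega> = ?r J \<omega>" if "J \<subseteq> (SIGMA j:UNIV. {..<H j})" "finite J" for J
    using that unfolding cond_indep_vars_def X_def by simp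
  have ball: "(\<forall>q\<in>{a} \<times> {..<n}. P q) \<longleftrightarrow> (\<forall>k'<n. P (a, k'))" for a :: 'n and n :: nat and P
    by auto
  have e: "{\<omega>' \<in> space M. \<forall>q\<in>?J1. X q \<omega>' \<in> S q} = C1"
    "{\<omega>' \<in> space M. \<forall>q\<in>?J2. X q \<omega>' \<in> S q} = C2"
    using ij unfolding ball C1 C2 S_def X_def by auto
  have e3: "{\<omega>' \<in> space M. \<forall>q\<in>?J1 \<union> ?J2. X q \<omega>' \<in> S q} = C1 \<inter> C2"
    unfolding e[symmetric] ball_Un by blast
  have "AE \<omega> in M. ?p (?J1 \<union> ?J2) \<omega> = ?r (?J1 \<union> ?J2) \<omega>"
    "AE \<omega> in M. ?p ?J1 \<omega> = ?r ?J1 \<omega>" "AE \<omega> in M. ?p ?J2 \<omega> = ?r ?J2 \<omega>"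
    using J by (intro ci; simp)+
  then show ?thesis
  proof eventually_elim
    case (elim \<omega>)
    have "?r (?J1 \<union> ?J2) \<omega> = ?r ?J1 \<omega> * ?r ?J2 \<omega>"
      using ij by (intro prod.union_disjoint) auto
    with elim show ?case unfolding e e3 by simp
  qed
qed

end

section \<open>The objective and the oracle noise\<close>

context hom_post_local
begin

abbreviation obj :: "real^'d \<Rightarrow> real" where
  "obj \<equiv> global_obj m \<phi>"

lemma L_smooth_node_obj: "L_smooth L (node_obj m \<phi> i)"
  using L_smooth_mean[of "{..<m i}" L "\<phi> i"] m_pos[of i] smooth[of _ i]
  by (auto simp: node_obj_def[abs_def] lessThan_empty_iff)

lemma L_smooth_obj: "L_smooth L obj"
  using L_smooth_mean[of UNIV L "node_obj m \<phi>"] L_smooth_node_obj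
  by (simp add: global_obj_def[abs_def])

lemma convex_obj: "convex_on UNIV obj"
proof -
  have "convex_on UNIV (node_obj m \<phi> i)" for i
    using convex_on_mean[of "{..<m i}" UNIV "\<phi> i"] m_pos[of i] convex[of _ i]
    by (auto simp: node_obj_def[abs_def] lessThan_empty_iff)
  then show ?thesis
    using convex_on_mean[of UNIV UNIV "node_obj m \<phi>"] by (simp add: global_obj_def[abs_def])
qed

lemma obj_min: "obj xs \<le> obj z"
  using minimizer unfolding is_arg_min_def by (meson not_le)

text \<open>Continuity of the gradients on the compact ball makes the supremum in \<open>node_var\<close> genuine;
  without boundedness it would be an unspecified number.\<close>

lemma node_var_nonneg: "0 \<le> node_var m \<phi> xs R i"
proof -
  let ?f = "\<lambda>z. (1 / real (m i)) * (\<Sum>j<m i. (norm (grad (\<phi> i j) z - grad (node_obj m \<phi> i) z))\<^sup>2)"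
  have "continuous_on (cball xs R) ?f"
    by (intro continuous_intros L_smooth_continuous_grad[of L] smooth L_smooth_node_obj) simp
  then have "bdd_above (?f ` cball xs R)"
    by (intro bounded_imp_bdd_above compact_imp_bounded compact_continuous_image compact_cball)
  then have "?f xs \<le> (SUP z\<in>cball xs R. ?f z)"
    using R_pos by (intro cSUP_upper) auto
  moreover have "0 \<le> ?f xs" by (simp add: sum_nonneg)
  ultimately show ?thesis unfolding node_var_def by (rule order_trans[rotated])
qed

lemma state_measurable: "x t \<in> borel_measurable M"
  by (rule measurable_from_subalg[OF subalgebra_round_hist state_measurable_round])

lemma grad_obj_measurable: "grad obj \<in> borel_measurable borel"
  by (intro borel_measurable_continuous_onI L_smooth_continuous_grad[OF L_smooth_obj])

lemma norm_grad_obj_ball: "z \<in> cball xs R \<Longrightarrow> norm (grad obj z) \<le> norm (grad obj xs) + L * R"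
proof -
  assume "z \<in> cball xs R"
  then have "L * norm (z - xs) \<le> L * R"
    using L_pos by (intro mult_left_mono) (auto simp: dist_norm norm_minus_commute)
  then show ?thesis
    using L_smooth_norm_grad_diff[OF L_smooth_obj, of z xs] norm_triangle_sub[of "grad obj z" "grad obj xs"]
    by linarith
qed

lemma grad_iterate_measurable:
  "l \<le> H i \<Longrightarrow> (\<lambda>\<omega>. grad obj (y i t l \<omega>)) \<in> borel_measurable (\<G> i t l)"
  using measurable_compose[OF iterate_measurable grad_obj_measurable] .

lemma square_integrable_state: "square_integrable M (x t)"
proof (rule square_integrable_bounded[OF state_measurable])
  show "AE \<omega> in M. norm (x t \<omega>) \<le> norm xs + R"
    using x_in_ball[of t]
    by eventually_elim (metis mem_cball add_left_mono dist_commute dist_norm norm_triangle_sub order_trans)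
qed

lemma square_integrable_iterate: "l \<le> H i \<Longrightarrow> square_integrable M (y i t l)"
proof (rule square_integrable_bounded)
  assume l: "l \<le> H i"
  show "y i t l \<in> borel_measurable M"
    by (rule measurable_from_subalg[OF subalgebra_local_hist iterate_measurable]) (fact l)+
  show "AE \<omega> in M. norm (y i t l \<omega>) \<le> norm xs + R"
    using y_in_ball[OF l, of t]
    by eventually_elim (metis mem_cball add_left_mono dist_commute dist_norm norm_triangle_sub order_trans)
qed

lemma square_integrable_grad_iterate:
  "l \<le> H i \<Longrightarrow> square_integrable M (\<lambda>\<omega>. grad obj (y i t l \<omega>))"
proof (rule square_integrable_bounded)
  assume l: "l \<le> H i"
  show "(\<lambda>\<omega>. grad obj (y i t l \<omega>)) \<in> borel_measurable M"
    by (rule measurable_from_subalg[OF subalgebra_local_hist grad_iterate_measurable]) (fact l)+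
  show "AE \<omega> in M. norm (grad obj (y i t l \<omega>)) \<le> norm (grad obj xs) + L * R"
    using y_in_ball[OF l, of t] by eventually_elim (rule norm_grad_obj_ball)
qed

lemma square_integrable_grad_state: "square_integrable M (\<lambda>\<omega>. grad obj (x t \<omega>))"
proof (rule square_integrable_bounded)
  show "(\<lambda>\<omega>. grad obj (x t \<omega>)) \<in> borel_measurable M"
    using measurable_compose[OF state_measurable grad_obj_measurable] .
  show "AE \<omega> in M. norm (grad obj (x t \<omega>)) \<le> norm (grad obj xs) + L * R"
    using x_in_ball[of t] by eventually_elim (rule norm_grad_obj_ball)
qed

lemma square_integrable_gap: "square_integrable M (\<lambda>\<omega>. obj (x t \<omega>) - obj xs)"
proof (rule square_integrable_bounded)
  show "(\<lambda>\<omega>. obj (x t \<omega>) - obj xs) \<in> borel_measurable M"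
    using measurable_compose[OF state_measurable
        borel_measurable_continuous_onI[OF L_smooth_continuous[OF L_smooth_obj]]]
    by (rule borel_measurable_diff) simp
  show "AE \<omega> in M. norm (obj (x t \<omega>) - obj xs) \<le> R * (norm (grad obj xs) + L * R)"
    using x_in_ball[of t]
  proof eventually_elim
    case (elim \<omega>)
    have "obj (x t \<omega>) - obj xs \<le> R * norm (grad obj (x t \<omega>))"
      by (rule convex_gap_le_norm_grad[OF L_smooth_obj convex_obj elim])
    also have "\<dots> \<le> R * (norm (grad obj xs) + L * R)"
      using norm_grad_obj_ball[OF elim] R_pos by (intro mult_left_mono) auto
    finally show ?case using obj_min[of "x t \<omega>"] by simp
  qed
qed

text \<open>The error of one stochastic gradient at the point where it is drawn.\<close>

definition noise :: "'n \<Rightarrow> nat \<Rightarrow> nat \<Rightarrow> 'w \<Rightarrow> real^'d" where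
  "noise i t l \<omega> = g i t l \<omega> - grad obj (y i t l \<omega>)"

lemma noise_measurable_local:
  assumes "l < H i"
  shows "noise i t l \<in> borel_measurable (\<G> i t (Suc l))"
proof -
  have "(\<lambda>\<omega>. grad obj (y i t l \<omega>)) \<in> borel_measurable (\<G> i t (Suc l))"
    using assms
    by (intro measurable_from_subalg[OF subalgebra_local_hist_mono[of l] grad_iterate_measurable]) auto
  then show ?thesis
    unfolding noise_def[abs_def] by (rule borel_measurable_diff[OF grad_measurable[OF assms]])
qed

lemma noise_measurable: "l < H i \<Longrightarrow> noise i t l \<in> borel_measurable M"
  by (rule measurable_from_subalg[OF subalgebra_local_hist noise_measurable_local]) auto

lemma nn_integral_noise_le:
  assumes l: "l < H i"
  shows "(\<integral>\<^sup>+\<omega>. ennreal ((norm (noise i t l \<omega>))\<^sup>2) \<partial>M) \<le> ennreal (node_var m \<phi> xs R i / real (b i))"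
proof -
  interpret G: sigma_finite_subalgebra M "\<G> i t l"
    using l by (intro subalgebra_sigma_finite subalgebra_local_hist) simp
  have meas: "(\<lambda>\<omega>. ennreal ((norm (noise i t l \<omega>))\<^sup>2)) \<in> borel_measurable M"
    using noise_measurable[OF l] by measurable
  have "(\<integral>\<^sup>+\<omega>. ennreal ((norm (noise i t l \<omega>))\<^sup>2) \<partial>M)
      = (\<integral>\<^sup>+\<omega>. nn_cond_exp M (\<G> i t l) (\<lambda>\<omega>'. ennreal ((norm (noise i t l \<omega>'))\<^sup>2)) \<omega> \<partial>M)"
    using G.nn_cond_exp_intg[OF _ meas, of "\<lambda>_. 1"] by simp
  also have "\<dots> \<le> (\<integral>\<^sup>+\<omega>. ennreal (node_var m \<phi> xs R i / real (b i)) \<partial>M)"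
    using oracle_variance[OF l, of t] unfolding noise_def by (rule nn_integral_mono_AE)
  also have "\<dots> = ennreal (node_var m \<phi> xs R i / real (b i))"
    by (simp add: emeasure_space_1)
  finally show ?thesis .
qed

lemma square_integrable_noise: "l < H i \<Longrightarrow> square_integrable M (noise i t l)"
  unfolding square_integrable_def
  using noise_measurable[of l i t] nn_integral_noise_le[of l i t]
  by (auto intro!: integrableI_bounded elim!: le_less_trans)

lemma expectation_noise_sq_le:
  assumes "l < H i"
  shows "(\<integral>\<omega>. (norm (noise i t l \<omega>))\<^sup>2 \<partial>M) \<le> node_var m \<phi> xs R i / real (b i)"
proof -
  have "ennreal (\<integral>\<omega>. (norm (noise i t l \<omega>))\<^sup>2 \<partial>M) \<le> ennreal (node_var m \<phi> xs R i / real (b i))"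
    using nn_integral_noise_le[OF assms, of t]
    by (subst nn_integral_eq_integral[symmetric])
      (auto intro: square_integrable_norm_sq square_integrable_noise[OF assms])
  then show ?thesis using node_var_nonneg[of i] by (simp add: ennreal_le_iff)
qed

lemma noise_cond_mean_zero:
  assumes l: "l < H i"
  shows "AE \<omega> in M. real_cond_exp M (\<G> i t l) (\<lambda>\<omega>. noise i t l \<omega> $ k) \<omega> = 0"
proof -
  interpret G: sigma_finite_subalgebra M "\<G> i t l"
    using l by (intro subalgebra_sigma_finite subalgebra_local_hist) simp
  let ?gr = "\<lambda>\<omega>. grad obj (y i t l \<omega>)"
  have gr: "square_integrable M ?gr"
    using l by (intro square_integrable_grad_iterate) simp
  have "(\<lambda>\<omega>. ?gr \<omega> $ k) \<in> borel_measurable (\<G> i t l)"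
    using borel_measurable_inner[OF grad_iterate_measurable[of l i t], of "\<lambda>_. axis k 1"] l
    by (simp add: inner_axis)
  then have 1: "AE \<omega> in M. real_cond_exp M (\<G> i t l) (\<lambda>\<omega>. ?gr \<omega> $ k) \<omega> = ?gr \<omega> $ k"
    by (rule G.real_cond_exp_F_meas[OF square_integrable_imp_integrable_component[OF gr]])
  have "square_integrable M (g i t l)"
    using square_integrable_add[OF square_integrable_noise[OF l, of t] gr] by (simp add: noise_def)
  from G.real_cond_exp_diff[OF square_integrable_imp_integrable_component[OF this, of k]
      square_integrable_imp_integrable_component[OF gr, of k]]
  have 2: "AE \<omega> in M. real_cond_exp M (\<G> i t l) (\<lambda>\<omega>. noise i t l \<omega> $ k) \<omega>
      = real_cond_exp M (\<G> i t l) (\<lambda>\<omega>. g i t l \<omega> $ k) \<omega>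
        - real_cond_exp M (\<G> i t l) (\<lambda>\<omega>. ?gr \<omega> $ k) \<omega>"
    by (simp add: noise_def)
  show ?thesis
    using 1 2 oracle_mean[OF l, of t]
  proof eventually_elim
    case (elim \<omega>)
    from elim(3) have "real_cond_exp M (\<G> i t l) (\<lambda>\<omega>. g i t l \<omega> $ k) \<omega> = ?gr \<omega> $ k"
      unfolding vec_cond_exp_def by (metis vec_lambda_beta)
    with elim show ?case by simp
  qed
qed

text \<open>By the tower property the mean also vanishes given only the history of the round, the
  sigma-algebra to which the conditional independence across nodes refers.\<close>

lemma noise_round_mean_zero:
  assumes l: "l < H i"
  shows "AE \<omega> in M. real_cond_exp M (\<G> i t 0) (\<lambda>\<omega>. noise i t l \<omega> $ k) \<omega> = 0"
proof -
  interpret G0: sigma_finite_subalgebra M "\<G> i t 0"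
    by (intro subalgebra_sigma_finite subalgebra_local_hist) simp
  interpret G: sigma_finite_subalgebra M "\<G> i t l"
    using l by (intro subalgebra_sigma_finite subalgebra_local_hist) simp
  let ?N = "\<lambda>\<omega>. noise i t l \<omega> $ k"
  have "AE \<omega> in M. real_cond_exp M (\<G> i t 0) (real_cond_exp M (\<G> i t l) ?N) \<omega>
      = real_cond_exp M (\<G> i t 0) ?N \<omega>"
    using l
    by (intro G0.real_cond_exp_nested_subalg subalgebra_local_hist subalgebra_local_hist_mono
        square_integrable_imp_integrable_component square_integrable_noise) auto
  moreover have "AE \<omega> in M. real_cond_exp M (\<G> i t 0) (real_cond_exp M (\<G> i t l) ?N) \<omega>
      = real_cond_exp M (\<G> i t 0) (\<lambda>_. 0) \<omega>"
    by (rule G0.real_cond_exp_cong[OF noise_cond_mean_zero[OF l] borel_measurable_cond_exp2]) simp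
  moreover have "AE \<omega> in M. real_cond_exp M (\<G> i t 0) (\<lambda>_. 0) \<omega> = 0"
    by (rule G0.real_cond_exp_F_meas) auto
  ultimately show ?thesis by eventually_elim simp
qed

lemma noise_orthogonal_same_node:
  assumes l: "l < k" "k < H i"
  shows "(\<integral>\<omega>. noise i t l \<omega> \<bullet> noise i t k \<omega> \<partial>M) = 0"
proof (rule vec_cond_exp_zero_imp_orthogonal)
  show "subalgebra M (\<G> i t k)" using l by (intro subalgebra_local_hist) simp
  show "noise i t l \<in> borel_measurable (\<G> i t k)"
    using l by (intro measurable_from_subalg[OF subalgebra_local_hist_mono[of "Suc l"]
          noise_measurable_local]) auto
qed (use l in \<open>auto intro: square_integrable_noise noise_cond_mean_zero\<close>)

lemma noise_orthogonal_other_node: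
  assumes ij: "i \<noteq> j" and l: "l < H i" "k < H j"
  shows "(\<integral>\<omega>. noise j t k \<omega> \<bullet> noise i t l \<omega> \<partial>M) = 0"
proof (rule vec_cond_exp_zero_imp_orthogonal)
  show sub: "subalgebra M (\<G> j t (Suc k))" using l by (intro subalgebra_local_hist) simp
  show "noise j t k \<in> borel_measurable (\<G> j t (Suc k))" by (rule noise_measurable_local[OF l(2)])
  fix k'
  have events: "batch_events i t (Suc l) \<subseteq> sets M" if "l < H i" for i l
    using batch_events_subset_local[of i t "Suc l"] subalgebra_local_hist[of "Suc l" i t] that
    by (auto simp: subalgebra_def)
  have comp: "(\<lambda>\<omega>. noise i t l \<omega> $ k') \<in> borel_measurable (\<G> i t (Suc l))"
    using borel_measurable_inner[OF noise_measurable_local[OF l(1), of t], of "\<lambda>_. axis k' 1"]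
    by (simp add: inner_axis)
  show "AE \<omega> in M. real_cond_exp M (\<G> j t (Suc k)) (\<lambda>\<omega>. noise i t l \<omega> $ k') \<omega> = 0"
  proof (rule cond_indep_cond_exp_zero[where F = "\<G> i t 0" and ?G1.0 = "\<G> i t (Suc l)"
        and ?E1.0 = "batch_events i t (Suc l)" and ?E2.0 = "batch_events j t (Suc k)"])
    show "subalgebra M (\<G> i t 0)" "subalgebra M (\<G> i t (Suc l))"
      using l by (intro subalgebra_local_hist; simp)+
    show "sets (\<G> j t (Suc k))
        = sigma_sets (space M) {A \<inter> C |A C. A \<in> sets (\<G> i t 0) \<and> C \<in> batch_events j t (Suc k)}"
      unfolding local_hist_0[of i t j] by (rule sets_local_hist_join)
    show "integrable M (\<lambda>\<omega>. noise i t l \<omega> $ k')"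
      by (intro square_integrable_imp_integrable_component square_integrable_noise l)
  qed (use ij l in \<open>intro sub batch_events_Int_stable space_in_batch_events events
      sets_local_hist_join batch_events_cond_indep comp noise_round_mean_zero; simp\<close>)+
qed (use l in \<open>auto intro: square_integrable_noise\<close>)

text \<open>Within a node the noise terms are martingale differences, across nodes they are conditionally
  independent, so all noise terms of a round are pairwise uncorrelated.\<close>

lemma noise_orthogonal:
  assumes "l < H i" "k < H j" "(i, l) \<noteq> (j, k)"
  shows "(\<integral>\<omega>. noise i t l \<omega> \<bullet> noise j t k \<omega> \<partial>M) = 0"
proof (cases "i = j")
  case True
  then show ?thesis
    using assms noise_orthogonal_same_node[of l k i t] noise_orthogonal_same_node[of k l i t]
    by (cases l k rule: linorder_cases) (auto simp: inner_commute)
next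
  case False
  then show ?thesis using assms noise_orthogonal_other_node[of j i k l t] by simp
qed

end

section \<open>Local drift\<close>

lemma norm_mean_sq_le:
  fixes f :: "'i \<Rightarrow> 'a::real_normed_vector"
  shows "(norm ((1 / real (card I)) *\<^sub>R (\<Sum>i\<in>I. f i)))\<^sup>2 \<le> (1 / real (card I)) * (\<Sum>i\<in>I. (norm (f i))\<^sup>2)"
proof (cases "card I = 0")
  case False
  have "(norm ((1 / real (card I)) *\<^sub>R (\<Sum>i\<in>I. f i)))\<^sup>2 = (1 / real (card I))\<^sup>2 * (norm (\<Sum>i\<in>I. f i))\<^sup>2"
    by (simp add: power_divide)
  also have "\<dots> \<le> (1 / real (card I))\<^sup>2 * (real (card I) * (\<Sum>i\<in>I. (norm (f i))\<^sup>2))"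
    by (intro mult_left_mono norm_sum_sq_le) simp
  also have "\<dots> = (1 / real (card I)) * (\<Sum>i\<in>I. (norm (f i))\<^sup>2)"
    using False by (simp add: power2_eq_square)
  finally show ?thesis .
qed simp

lemma sum_lessThan_real_le: "(\<Sum>l<h. real l) \<le> (real h)\<^sup>2 / 2"
  by (induction h) (auto simp: power2_eq_square algebra_simps)

text \<open>The recursion for the mean squared distances \<open>D l\<close> of the local iterates from the start of
  the round. Summing it over the round, instead of bounding the largest \<open>D l\<close>, gains the factor
  \<open>1 / 2\<close> from \<open>sum_lessThan_real_le\<close>; it is what makes \<open>\<theta> \<le> 1 / 2\<close> sufficient.\<close>

lemma drift_recursion:
  fixes D :: "nat \<Rightarrow> real"
  assumes D: "\<And>l. 0 \<le> D l" and h: "0 < h" and L: "0 < L" and \<theta>: "0 \<le> \<theta>" "\<theta> \<le> 1 / 2"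
    and \<sigma>: "0 \<le> \<sigma>" and a: "0 \<le> a"
    and rec: "\<And>l. l < h \<Longrightarrow> D l \<le> 2 * (\<theta> / (L * real h))\<^sup>2 * real l
          * (\<sigma> + (\<Sum>k<l. 2 * a + 2 * L\<^sup>2 * D k))"
  shows "L\<^sup>2 * ((1 / real h) * (\<Sum>l<h. D l)) \<le> 4 * \<theta>\<^sup>2 * a + 2 * \<theta>\<^sup>2 * (\<sigma> / real h)"
proof -
  define S where "S = (\<Sum>l<h. D l)"
  define \<eta> where "\<eta> = \<theta> / (L * real h)"
  have S0: "0 \<le> S" unfolding S_def by (intro sum_nonneg D)
  have "S \<le> (\<Sum>l<h. real l * (2 * \<eta>\<^sup>2 * (\<sigma> + (2 * real h * a + 2 * L\<^sup>2 * S))))"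
    unfolding S_def
  proof (rule sum_mono)
    fix l assume "l \<in> {..<h}"
    then have l: "l < h" by simp
    have "(\<Sum>k<l. 2 * a + 2 * L\<^sup>2 * D k) \<le> (\<Sum>k<h. 2 * a + 2 * L\<^sup>2 * D k)"
      using l a D by (intro sum_mono2) auto
    also have "\<dots> = 2 * real h * a + 2 * L\<^sup>2 * (\<Sum>l<h. D l)"
      by (simp add: sum.distrib sum_distrib_left)
    finally have "2 * \<eta>\<^sup>2 * real l * (\<sigma> + (\<Sum>k<l. 2 * a + 2 * L\<^sup>2 * D k))
        \<le> 2 * \<eta>\<^sup>2 * real l * (\<sigma> + (2 * real h * a + 2 * L\<^sup>2 * (\<Sum>l<h. D l)))"
      by (intro mult_left_mono) auto
    with rec[OF l] show "D l \<le> real l * (2 * \<eta>\<^sup>2 * (\<sigma> + (2 * real h * a + 2 * L\<^sup>2 * (\<Sum>l<h. D l))))"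
      unfolding \<eta>_def by (simp add: mult_ac)
  qed
  also have "\<dots> = (\<Sum>l<h. real l) * (2 * \<eta>\<^sup>2 * (\<sigma> + (2 * real h * a + 2 * L\<^sup>2 * S)))"
    by (simp add: sum_distrib_right)
  also have "\<dots> \<le> (real h)\<^sup>2 / 2 * (2 * \<eta>\<^sup>2 * (\<sigma> + (2 * real h * a + 2 * L\<^sup>2 * S)))"
    using \<sigma> a S0 by (intro mult_right_mono sum_lessThan_real_le) auto
  also have "\<dots> = (\<eta> * real h)\<^sup>2 * (\<sigma> + (2 * real h * a + 2 * L\<^sup>2 * S))"
    by (simp add: power_mult_distrib)
  also have "\<eta> * real h = \<theta> / L" using h by (simp add: \<eta>_def)
  finally have "L\<^sup>2 * S \<le> L\<^sup>2 * ((\<theta> / L)\<^sup>2 * (\<sigma> + (2 * real h * a + 2 * L\<^sup>2 * S)))"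
    by (intro mult_left_mono) auto
  also have "\<dots> = \<theta>\<^sup>2 * (\<sigma> + 2 * real h * a) + 2 * \<theta>\<^sup>2 * (L\<^sup>2 * S)"
    using L by (simp add: power_divide algebra_simps)
  also have "2 * \<theta>\<^sup>2 * (L\<^sup>2 * S) \<le> 1 / 2 * (L\<^sup>2 * S)"
  proof (intro mult_right_mono)
    have "\<theta>\<^sup>2 \<le> (1 / 2)\<^sup>2" using \<theta> by (intro power_mono)
    then show "2 * \<theta>\<^sup>2 \<le> 1 / 2" by (simp add: power_divide)
  qed (use S0 in simp)
  finally have "L\<^sup>2 * S \<le> 2 * \<theta>\<^sup>2 * (\<sigma> + 2 * real h * a)" by simp
  then have "L\<^sup>2 * S / real h \<le> 2 * \<theta>\<^sup>2 * (\<sigma> + 2 * real h * a) / real h"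
    by (rule divide_right_mono) simp
  also have "\<dots> = 4 * \<theta>\<^sup>2 * a + 2 * \<theta>\<^sup>2 * (\<sigma> / real h)"
    using h by (simp add: field_simps)
  finally show ?thesis by (simp add: S_def)
qed

context hom_post_local
begin

abbreviation (input) grad_sq :: "nat \<Rightarrow> real" where
  "grad_sq t \<equiv> \<integral>\<omega>. (norm (grad obj (x t \<omega>)))\<^sup>2 \<partial>M"

lemma theta_pos: "0 < \<theta> t"
  using \<theta>_range[of t] \<theta>_bounds by auto

lemma step_size_H: "step_size L H a i * real (H i) = a / L"
  using H_pos[of i] by (simp add: step_size_def)

lemma local_displacement:
  assumes "\<omega> \<in> space M" "l \<le> H i"
  shows "y i t l \<omega> - x t \<omega> = - step_size L H (\<theta> t) i *\<^sub>R (\<Sum>k<l. g i t k \<omega>)"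
  using assms(2)
proof (induction l)
  case 0
  then show ?case using local_init[OF assms(1)] by simp
next
  case (Suc l)
  then have "y i t (Suc l) \<omega> - x t \<omega> = (y i t l \<omega> - x t \<omega>) - step_size L H (\<theta> t) i *\<^sub>R g i t l \<omega>"
    using local_step[OF _ assms(1), of l i t] by simp
  also have "\<dots> = - step_size L H (\<theta> t) i *\<^sub>R (\<Sum>k<Suc l. g i t k \<omega>)"
    using Suc by (simp add: scaleR_add_right)
  finally show ?case .
qed

lemma noise_sum_sq_le:
  assumes "l \<le> H i"
  shows "(\<integral>\<omega>. (norm (\<Sum>k<l. noise i t k \<omega>))\<^sup>2 \<partial>M) \<le> real l * (node_var m \<phi> xs R i / real (b i))"
proof -
  have "(\<integral>\<omega>. (norm (\<Sum>k<l. noise i t k \<omega>))\<^sup>2 \<partial>M) = (\<Sum>k<l. \<integral>\<omega>. (norm (noise i t k \<omega>))\<^sup>2 \<partial>M)"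
    using assms
    by (intro integral_norm_sq_sum_orthogonal square_integrable_noise noise_orthogonal) auto
  also have "\<dots> \<le> (\<Sum>k<l. node_var m \<phi> xs R i / real (b i))"
    using assms by (intro sum_mono expectation_noise_sq_le) auto
  finally show ?thesis by simp
qed

text \<open>Of the constants below, one factor 2 separates the noise from the gradients along the local
  path, the other one the gradient at the start of the round from its variation.\<close>

lemma displacement_sq_recursion:
  assumes l: "l \<le> H i"
  shows "(\<integral>\<omega>. (norm (y i t l \<omega> - x t \<omega>))\<^sup>2 \<partial>M)
    \<le> 2 * (step_size L H (\<theta> t) i)\<^sup>2 * real l * (node_var m \<phi> xs R i / real (b i)
        + (\<Sum>k<l. 2 * grad_sq t + 2 * L\<^sup>2 * (\<integral>\<omega>. (norm (y i t k \<omega> - x t \<omega>))\<^sup>2 \<partial>M)))"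
proof -
  let ?\<eta> = "step_size L H (\<theta> t) i"
  let ?D = "\<lambda>k \<omega>. (norm (y i t k \<omega> - x t \<omega>))\<^sup>2"
  let ?G = "\<lambda>\<omega>. (norm (grad obj (x t \<omega>)))\<^sup>2"
  let ?N = "\<lambda>\<omega>. (norm (\<Sum>k<l. noise i t k \<omega>))\<^sup>2"
  have iD: "integrable M (?D k)" if "k \<le> l" for k
    using that l
    by (intro square_integrable_norm_sq square_integrable_diff square_integrable_iterate
        square_integrable_state) simp
  have iG: "integrable M ?G" by (intro square_integrable_norm_sq square_integrable_grad_state)
  have iN: "integrable M ?N"
    using l by (intro square_integrable_norm_sq square_integrable_sum square_integrable_noise) auto
  have pt: "?D l \<omega> \<le> 2 * ?\<eta>\<^sup>2 * (?N \<omega> + real l * (\<Sum>k<l. 2 * ?G \<omega> + 2 * L\<^sup>2 * ?D k \<omega>))"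
    if \<omega>: "\<omega> \<in> space M" for \<omega>
  proof -
    have "(\<Sum>k<l. g i t k \<omega>) = (\<Sum>k<l. noise i t k \<omega>) + (\<Sum>k<l. grad obj (y i t k \<omega>))"
      by (simp add: noise_def sum_subtractf)
    then have "?D l \<omega> = ?\<eta>\<^sup>2 * (norm ((\<Sum>k<l. noise i t k \<omega>) + (\<Sum>k<l. grad obj (y i t k \<omega>))))\<^sup>2"
      unfolding local_displacement[OF \<omega> l] by (simp add: power_mult_distrib)
    also have "\<dots> \<le> ?\<eta>\<^sup>2 * (2 * ?N \<omega> + 2 * (norm (\<Sum>k<l. grad obj (y i t k \<omega>)))\<^sup>2)"
      by (intro mult_left_mono norm_add_sq_le) simp
    also have "\<dots> = 2 * ?\<eta>\<^sup>2 * (?N \<omega> + (norm (\<Sum>k<l. grad obj (y i t k \<omega>)))\<^sup>2)"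
      by (simp add: algebra_simps)
    finally have 1: "?D l \<omega> \<le> 2 * ?\<eta>\<^sup>2 * (?N \<omega> + (norm (\<Sum>k<l. grad obj (y i t k \<omega>)))\<^sup>2)" .
    have "(norm (\<Sum>k<l. grad obj (y i t k \<omega>)))\<^sup>2
        \<le> real l * (\<Sum>k<l. (norm (grad obj (y i t k \<omega>)))\<^sup>2)"
      using norm_sum_sq_le[of "\<lambda>k. grad obj (y i t k \<omega>)" "{..<l}"] by simp
    also have "\<dots> \<le> real l * (\<Sum>k<l. 2 * ?G \<omega> + 2 * L\<^sup>2 * ?D k \<omega>)"
    proof (intro mult_left_mono sum_mono)
      fix k
      let ?d = "grad obj (y i t k \<omega>) - grad obj (x t \<omega>)"
      have "(norm ?d)\<^sup>2 \<le> (L * norm (y i t k \<omega> - x t \<omega>))\<^sup>2"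
        by (intro power_mono L_smooth_norm_grad_diff L_smooth_obj) simp
      then show "(norm (grad obj (y i t k \<omega>)))\<^sup>2 \<le> 2 * ?G \<omega> + 2 * L\<^sup>2 * ?D k \<omega>"
        using norm_add_sq_le[of "grad obj (x t \<omega>)" ?d] by (simp add: power_mult_distrib)
    qed simp
    finally have "2 * ?\<eta>\<^sup>2 * (?N \<omega> + (norm (\<Sum>k<l. grad obj (y i t k \<omega>)))\<^sup>2)
        \<le> 2 * ?\<eta>\<^sup>2 * (?N \<omega> + real l * (\<Sum>k<l. 2 * ?G \<omega> + 2 * L\<^sup>2 * ?D k \<omega>))"
      by (intro mult_left_mono add_left_mono) auto
    with 1 show ?thesis by (rule order_trans)
  qed
  have iK: "integrable M (\<lambda>\<omega>. 2 * ?G \<omega> + 2 * L\<^sup>2 * ?D k \<omega>)" if "k < l" for k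
    using that
    by (intro Bochner_Integration.integrable_add integrable_mult_right iG iD) simp
  then have iS: "integrable M (\<lambda>\<omega>. \<Sum>k<l. 2 * ?G \<omega> + 2 * L\<^sup>2 * ?D k \<omega>)"
    by (intro Bochner_Integration.integrable_sum) simp
  have "(\<integral>\<omega>. (\<Sum>k<l. 2 * ?G \<omega> + 2 * L\<^sup>2 * ?D k \<omega>) \<partial>M)
      = (\<Sum>k<l. \<integral>\<omega>. 2 * ?G \<omega> + 2 * L\<^sup>2 * ?D k \<omega> \<partial>M)"
    using iK by (intro Bochner_Integration.integral_sum) simp
  also have "\<dots> = (\<Sum>k<l. 2 * grad_sq t + 2 * L\<^sup>2 * (\<integral>\<omega>. ?D k \<omega> \<partial>M))"
    by (intro sum.cong refl) (simp add: iG iD)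
  finally have eS: "(\<integral>\<omega>. (\<Sum>k<l. 2 * ?G \<omega> + 2 * L\<^sup>2 * ?D k \<omega>) \<partial>M)
      = (\<Sum>k<l. 2 * grad_sq t + 2 * L\<^sup>2 * (\<integral>\<omega>. ?D k \<omega> \<partial>M))" .
  have "(\<integral>\<omega>. ?D l \<omega> \<partial>M)
      \<le> (\<integral>\<omega>. 2 * ?\<eta>\<^sup>2 * (?N \<omega> + real l * (\<Sum>k<l. 2 * ?G \<omega> + 2 * L\<^sup>2 * ?D k \<omega>)) \<partial>M)"
    by (intro integral_mono pt integrable_mult_right Bochner_Integration.integrable_add
        iN iS iD) auto
  also have "\<dots> = 2 * ?\<eta>\<^sup>2 * ((\<integral>\<omega>. ?N \<omega> \<partial>M)
      + real l * (\<Sum>k<l. 2 * grad_sq t + 2 * L\<^sup>2 * (\<integral>\<omega>. ?D k \<omega> \<partial>M)))"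
    unfolding integral_mult_right_zero
      Bochner_Integration.integral_add[OF iN integrable_mult_right[OF iS]] eS ..
  also have "\<dots> \<le> 2 * ?\<eta>\<^sup>2 * (real l * (node_var m \<phi> xs R i / real (b i))
      + real l * (\<Sum>k<l. 2 * grad_sq t + 2 * L\<^sup>2 * (\<integral>\<omega>. ?D k \<omega> \<partial>M)))"
    by (intro mult_left_mono add_right_mono noise_sum_sq_le l) simp
  finally show ?thesis by (simp add: algebra_simps)
qed

lemma mean_drift_le:
  assumes \<theta>: "\<theta> t \<le> 1 / 2"
  shows "L\<^sup>2 * ((1 / real (H i)) * (\<Sum>l<H i. \<integral>\<omega>. (norm (y i t l \<omega> - x t \<omega>))\<^sup>2 \<partial>M))
    \<le> 4 * (\<theta> t)\<^sup>2 * grad_sq t + 2 * (\<theta> t)\<^sup>2 * (node_var m \<phi> xs R i / (real (H i) * real (b i)))"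
proof -
  have "L\<^sup>2 * ((1 / real (H i)) * (\<Sum>l<H i. \<integral>\<omega>. (norm (y i t l \<omega> - x t \<omega>))\<^sup>2 \<partial>M))
    \<le> 4 * (\<theta> t)\<^sup>2 * grad_sq t + 2 * (\<theta> t)\<^sup>2 * (node_var m \<phi> xs R i / real (b i) / real (H i))"
  proof (rule drift_recursion)
    show "0 < H i" using H_pos[of i] by simp
    fix l assume "l < H i"
    then show "(\<integral>\<omega>. (norm (y i t l \<omega> - x t \<omega>))\<^sup>2 \<partial>M)
      \<le> 2 * (\<theta> t / (L * real (H i)))\<^sup>2 * real l * (node_var m \<phi> xs R i / real (b i)
        + (\<Sum>k<l. 2 * grad_sq t + 2 * L\<^sup>2 * (\<integral>\<omega>. (norm (y i t k \<omega> - x t \<omega>))\<^sup>2 \<partial>M)))"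
      using displacement_sq_recursion[of l i t] by (simp add: step_size_def)
  qed (use L_pos theta_pos[of t] \<theta> node_var_nonneg[of i] in auto)
  then show ?thesis by (simp add: mult.commute)
qed

section \<open>The averaged local gradient\<close>

text \<open>\<open>mean_grad t\<close> is the slope used by the server. Its error as an estimate of the gradient
  at \<open>x t\<close> splits into \<open>noise_part t\<close>, a weighted sum of uncorrelated noise terms, and
  \<open>drift_part t\<close>, the averaged variation of the gradient along the local paths.\<close>

definition mean_grad :: "nat \<Rightarrow> 'w \<Rightarrow> real^'d" where
  "mean_grad t \<omega> = avg_local_grad H (step_size L H (\<theta> t)) (\<lambda>i. y i t (H i) \<omega> - x t \<omega>)"

definition noise_part :: "nat \<Rightarrow> 'w \<Rightarrow> real^'d" where
  "noise_part t \<omega>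
     = (\<Sum>(i, l)\<in>(SIGMA i:UNIV. {..<H i}). (1 / (real CARD('n) * real (H i))) *\<^sub>R noise i t l \<omega>)"

definition drift_part :: "nat \<Rightarrow> 'w \<Rightarrow> real^'d" where
  "drift_part t \<omega> = (1 / real CARD('n)) *\<^sub>R (\<Sum>i\<in>UNIV. (1 / real (H i)) *\<^sub>R
     (\<Sum>l<H i. grad obj (y i t l \<omega>) - grad obj (x t \<omega>)))"

lemma mean_grad_error:
  assumes \<omega>: "\<omega> \<in> space M"
  shows "mean_grad t \<omega> - grad obj (x t \<omega>) = noise_part t \<omega> + drift_part t \<omega>"
proof -
  have H0: "0 < real (H i)" for i using H_pos[of i] by simp
  have loc: "- inverse (step_size L H (\<theta> t) i * real (H i)) *\<^sub>R (y i t (H i) \<omega> - x t \<omega>)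
      = (1 / real (H i)) *\<^sub>R (\<Sum>l<H i. noise i t l \<omega>)
        + (1 / real (H i)) *\<^sub>R (\<Sum>l<H i. grad obj (y i t l \<omega>) - grad obj (x t \<omega>))
        + grad obj (x t \<omega>)" for i
  proof -
    have "step_size L H (\<theta> t) i \<noteq> 0"
      using L_pos theta_pos[of t] H0[of i] by (simp add: step_size_def)
    then have "- inverse (step_size L H (\<theta> t) i * real (H i)) *\<^sub>R (y i t (H i) \<omega> - x t \<omega>)
        = (1 / real (H i)) *\<^sub>R (\<Sum>l<H i. g i t l \<omega>)"
      unfolding local_displacement[OF \<omega> order_refl] by (simp add: inverse_eq_divide)
    also have "(\<Sum>l<H i. g i t l \<omega>) = (\<Sum>l<H i. noise i t l \<omega>)
        + (\<Sum>l<H i. grad obj (y i t l \<omega>) - grad obj (x t \<omega>)) + real (H i) *\<^sub>R grad obj (x t \<omega>)"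
      by (simp add: noise_def sum_subtractf sum_constant_scaleR del: sum_constant)
    finally show ?thesis using H0[of i] by (simp add: scaleR_add_right)
  qed
  have "noise_part t \<omega>
      = (1 / real CARD('n)) *\<^sub>R (\<Sum>i\<in>UNIV. (1 / real (H i)) *\<^sub>R (\<Sum>l<H i. noise i t l \<omega>))"
    unfolding noise_part_def
    by (subst sum.Sigma[symmetric]) (simp_all add: scaleR_sum_right)
  then show ?thesis
    unfolding mean_grad_def avg_local_grad_def loc drift_part_def
    by (simp add: sum.distrib scaleR_add_right sum_constant_scaleR del: sum_constant)
qed

lemma square_integrable_noise_part: "square_integrable M (noise_part t)"
proof -
  have "square_integrable M (\<lambda>\<omega>. \<Sum>p\<in>(SIGMA i:UNIV. {..<H i}).
      (1 / (real CARD('n) * real (H (fst p)))) *\<^sub>R noise (fst p) t (snd p) \<omega>)"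
    by (intro square_integrable_sum square_integrable_scaleR square_integrable_noise) auto
  then show ?thesis by (simp add: noise_part_def[abs_def] case_prod_beta')
qed

text \<open>Averaging over the nodes reduces the noise: since all noise terms are uncorrelated, the
  squared weights add up to \<open>V_u\<close>, with a factor \<open>1 / CARD('n)\<close> compared with \<open>V_bar1\<close>.\<close>

lemma expectation_noise_part_sq_le:
  "(\<integral>\<omega>. (norm (noise_part t \<omega>))\<^sup>2 \<partial>M) \<le> V_u (node_var m \<phi> xs R) H b"
proof -
  let ?P = "SIGMA i:(UNIV :: 'n set). {..<H i}"
  let ?a = "\<lambda>i. 1 / (real CARD('n) * real (H i))"
  let ?v = "node_var m \<phi> xs R"
  let ?X = "\<lambda>p \<omega>. ?a (fst p) *\<^sub>R noise (fst p) t (snd p) \<omega>"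
  have "(\<integral>\<omega>. (norm (noise_part t \<omega>))\<^sup>2 \<partial>M) = (\<integral>\<omega>. (norm (\<Sum>p\<in>?P. ?X p \<omega>))\<^sup>2 \<partial>M)"
    by (simp add: noise_part_def case_prod_beta')
  also have "\<dots> = (\<Sum>p\<in>?P. \<integral>\<omega>. (norm (?X p \<omega>))\<^sup>2 \<partial>M)"
  proof (rule integral_norm_sq_sum_orthogonal)
    fix p q assume "p \<in> ?P" "q \<in> ?P" "p \<noteq> q"
    then have "(\<integral>\<omega>. noise (fst p) t (snd p) \<omega> \<bullet> noise (fst q) t (snd q) \<omega> \<partial>M) = 0"
      by (intro noise_orthogonal) (auto simp: prod_eq_iff)
    then show "(\<integral>\<omega>. ?X p \<omega> \<bullet> ?X q \<omega> \<partial>M) = 0" by simp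
  qed (auto intro!: square_integrable_scaleR square_integrable_noise)
  also have "\<dots> \<le> (\<Sum>p\<in>?P. (?a (fst p))\<^sup>2 * (?v (fst p) / real (b (fst p))))"
  proof (rule sum_mono)
    fix p assume "p \<in> ?P"
    then have "(\<integral>\<omega>. (norm (noise (fst p) t (snd p) \<omega>))\<^sup>2 \<partial>M) \<le> ?v (fst p) / real (b (fst p))"
      by (intro expectation_noise_sq_le) auto
    then have "(?a (fst p))\<^sup>2 * (\<integral>\<omega>. (norm (noise (fst p) t (snd p) \<omega>))\<^sup>2 \<partial>M)
        \<le> (?a (fst p))\<^sup>2 * (?v (fst p) / real (b (fst p)))"
      by (rule mult_left_mono) simp
    then show "(\<integral>\<omega>. (norm (?X p \<omega>))\<^sup>2 \<partial>M) \<le> (?a (fst p))\<^sup>2 * (?v (fst p) / real (b (fst p)))"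
      by (simp add: power_divide)
  qed
  also have "\<dots> = (\<Sum>i\<in>UNIV. \<Sum>l<H i. (?a i)\<^sup>2 * (?v i / real (b i)))"
    by (subst sum.Sigma) (auto simp: case_prod_beta')
  also have "\<dots> = V_u ?v H b"
  proof -
    have "(\<Sum>l<H i. (?a i)\<^sup>2 * (?v i / real (b i)))
        = (1 / (real CARD('n))\<^sup>2) * (?v i / (real (H i) * real (b i)))" for i
      using H_pos[of i] by (simp add: power2_eq_square field_simps)
    then show ?thesis by (simp add: V_u_def sum_distrib_left)
  qed
  finally show ?thesis .
qed

lemma square_integrable_drift_part: "square_integrable M (drift_part t)"
  unfolding drift_part_def[abs_def]
  by (intro square_integrable_scaleR square_integrable_sum square_integrable_diff
      square_integrable_grad_iterate square_integrable_grad_state) auto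

lemma expectation_drift_part_sq_le:
  assumes \<theta>: "\<theta> t \<le> 1 / 2"
  shows "(\<integral>\<omega>. (norm (drift_part t \<omega>))\<^sup>2 \<partial>M)
    \<le> 4 * (\<theta> t)\<^sup>2 * grad_sq t + 2 * (\<theta> t)\<^sup>2 * V_bar1 (node_var m \<phi> xs R) H b"
proof -
  let ?D = "\<lambda>i l \<omega>. (norm (y i t l \<omega> - x t \<omega>))\<^sup>2"
  let ?v = "node_var m \<phi> xs R"
  have iD: "integrable M (?D i l)" if "l < H i" for i l
    using that
    by (intro square_integrable_norm_sq square_integrable_diff square_integrable_iterate
        square_integrable_state) simp
  have pt: "(norm (drift_part t \<omega>))\<^sup>2
      \<le> (1 / real CARD('n)) * (\<Sum>i\<in>UNIV. L\<^sup>2 * ((1 / real (H i)) * (\<Sum>l<H i. ?D i l \<omega>)))" for \<omega>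
  proof -
    have "(norm ((1 / real (H i)) *\<^sub>R (\<Sum>l<H i. grad obj (y i t l \<omega>) - grad obj (x t \<omega>))))\<^sup>2
        \<le> L\<^sup>2 * ((1 / real (H i)) * (\<Sum>l<H i. ?D i l \<omega>))" for i
    proof -
      have "(norm ((1 / real (H i)) *\<^sub>R (\<Sum>l<H i. grad obj (y i t l \<omega>) - grad obj (x t \<omega>))))\<^sup>2
          \<le> (1 / real (H i)) * (\<Sum>l<H i. (norm (grad obj (y i t l \<omega>) - grad obj (x t \<omega>)))\<^sup>2)"
        using norm_mean_sq_le[of "{..<H i}" "\<lambda>l. grad obj (y i t l \<omega>) - grad obj (x t \<omega>)"] by simp
      also have "\<dots> \<le> (1 / real (H i)) * (\<Sum>l<H i. (L * norm (y i t l \<omega> - x t \<omega>))\<^sup>2)"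
        by (intro mult_left_mono sum_mono power_mono L_smooth_norm_grad_diff L_smooth_obj) auto
      also have "\<dots> = L\<^sup>2 * ((1 / real (H i)) * (\<Sum>l<H i. ?D i l \<omega>))"
        by (simp add: power_mult_distrib sum_distrib_left[symmetric])
      finally show ?thesis .
    qed
    then have "(1 / real CARD('n)) * (\<Sum>i\<in>UNIV.
          (norm ((1 / real (H i)) *\<^sub>R (\<Sum>l<H i. grad obj (y i t l \<omega>) - grad obj (x t \<omega>))))\<^sup>2)
        \<le> (1 / real CARD('n)) * (\<Sum>i\<in>UNIV. L\<^sup>2 * ((1 / real (H i)) * (\<Sum>l<H i. ?D i l \<omega>)))"
      by (intro mult_left_mono sum_mono) auto
    with norm_mean_sq_le[of UNIV] show ?thesis
      unfolding drift_part_def by (rule order_trans)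
  qed
  have "(\<integral>\<omega>. (norm (drift_part t \<omega>))\<^sup>2 \<partial>M)
      \<le> (\<integral>\<omega>. (1 / real CARD('n)) * (\<Sum>i\<in>UNIV. L\<^sup>2 * ((1 / real (H i)) * (\<Sum>l<H i. ?D i l \<omega>))) \<partial>M)"
    by (intro integral_mono pt integrable_mult_right Bochner_Integration.integrable_sum iD
        square_integrable_norm_sq square_integrable_drift_part) auto
  also have "\<dots> = (1 / real CARD('n)) *
      (\<Sum>i\<in>UNIV. L\<^sup>2 * ((1 / real (H i)) * (\<Sum>l<H i. \<integral>\<omega>. ?D i l \<omega> \<partial>M)))"
  proof -
    have int: "integrable M (\<lambda>\<omega>. \<Sum>l<H i. ?D i l \<omega>)" for i
      by (intro Bochner_Integration.integrable_sum iD) simp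
    have "(\<integral>\<omega>. (\<Sum>l<H i. ?D i l \<omega>) \<partial>M) = (\<Sum>l<H i. \<integral>\<omega>. ?D i l \<omega> \<partial>M)" for i
      by (intro Bochner_Integration.integral_sum iD) simp
    then show ?thesis
      by (subst integral_mult_right_zero, subst Bochner_Integration.integral_sum)
        (intro integrable_mult_right int, simp only: integral_mult_right_zero)
  qed
  also have "\<dots> \<le> (1 / real CARD('n)) * (\<Sum>i\<in>(UNIV :: 'n set).
      4 * (\<theta> t)\<^sup>2 * grad_sq t + 2 * (\<theta> t)\<^sup>2 * (?v i / (real (H i) * real (b i))))"
    by (intro mult_left_mono sum_mono mean_drift_le \<theta>) simp
  also have "\<dots> = 4 * (\<theta> t)\<^sup>2 * grad_sq t + 2 * (\<theta> t)\<^sup>2 * V_bar1 ?v H b"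
    unfolding V_bar1_def sum.distrib sum_distrib_left[symmetric] by (simp add: distrib_left)
  finally show ?thesis .
qed

lemma exp_gap_eq: "exp_gap M m \<phi> xs x t = (\<integral>\<omega>. obj (x t \<omega>) - obj xs \<partial>M)"
  by (simp add: exp_gap_def)

text \<open>Smoothness turns the squared gradients left over from the drift into multiples of the gap.\<close>

lemma grad_sq_le: "grad_sq t \<le> 2 * L * exp_gap M m \<phi> xs x t"
proof -
  have "grad_sq t \<le> (\<integral>\<omega>. 2 * L * (obj (x t \<omega>) - obj xs) \<partial>M)"
    using square_integrable_gap[of t]
    by (intro integral_mono integrable_mult_right square_integrable_norm_sq
        square_integrable_grad_state square_integrable_imp_integrable
        L_smooth_norm_grad_sq_le L_smooth_obj L_pos obj_min)
  then show ?thesis by (simp add: exp_gap_eq)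
qed

lemma expectation_mean_grad_error_sq_le:
  assumes \<theta>: "\<theta> t \<le> 1 / 2"
  shows "integrable M (\<lambda>\<omega>. (norm (mean_grad t \<omega> - grad obj (x t \<omega>)))\<^sup>2)"
    and "(\<integral>\<omega>. (norm (mean_grad t \<omega> - grad obj (x t \<omega>)))\<^sup>2 \<partial>M)
      \<le> 16 * L * (\<theta> t)\<^sup>2 * exp_gap M m \<phi> xs x t
        + 4 * (\<theta> t)\<^sup>2 * V_bar1 (node_var m \<phi> xs R) H b + 2 * V_u (node_var m \<phi> xs R) H b"
proof -
  let ?N = "noise_part t" and ?D = "drift_part t"
  have eq: "integrable M (\<lambda>\<omega>. (norm (mean_grad t \<omega> - grad obj (x t \<omega>)))\<^sup>2)
      \<longleftrightarrow> integrable M (\<lambda>\<omega>. (norm (?N \<omega> + ?D \<omega>))\<^sup>2)"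
    "(\<integral>\<omega>. (norm (mean_grad t \<omega> - grad obj (x t \<omega>)))\<^sup>2 \<partial>M) = (\<integral>\<omega>. (norm (?N \<omega> + ?D \<omega>))\<^sup>2 \<partial>M)"
    by (intro Bochner_Integration.integrable_cong Bochner_Integration.integral_cong;
        simp add: mean_grad_error)+
  have i: "integrable M (\<lambda>\<omega>. (norm (?N \<omega>))\<^sup>2)" "integrable M (\<lambda>\<omega>. (norm (?D \<omega>))\<^sup>2)"
    "integrable M (\<lambda>\<omega>. (norm (?N \<omega> + ?D \<omega>))\<^sup>2)"
    by (intro square_integrable_norm_sq square_integrable_add square_integrable_noise_part
        square_integrable_drift_part)+
  with eq(1) show "integrable M (\<lambda>\<omega>. (norm (mean_grad t \<omega> - grad obj (x t \<omega>)))\<^sup>2)" by simp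
  have "(\<integral>\<omega>. (norm (?N \<omega> + ?D \<omega>))\<^sup>2 \<partial>M) \<le> (\<integral>\<omega>. 2 * (norm (?N \<omega>))\<^sup>2 + 2 * (norm (?D \<omega>))\<^sup>2 \<partial>M)"
    using i by (intro integral_mono norm_add_sq_le) auto
  also have "\<dots> = 2 * (\<integral>\<omega>. (norm (?N \<omega>))\<^sup>2 \<partial>M) + 2 * (\<integral>\<omega>. (norm (?D \<omega>))\<^sup>2 \<partial>M)"
    using i by simp
  finally have 1: "(\<integral>\<omega>. (norm (mean_grad t \<omega> - grad obj (x t \<omega>)))\<^sup>2 \<partial>M)
      \<le> 2 * (\<integral>\<omega>. (norm (?N \<omega>))\<^sup>2 \<partial>M) + 2 * (\<integral>\<omega>. (norm (?D \<omega>))\<^sup>2 \<partial>M)"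
    unfolding eq(2) .
  have "4 * (\<theta> t)\<^sup>2 * grad_sq t \<le> 4 * (\<theta> t)\<^sup>2 * (2 * L * exp_gap M m \<phi> xs x t)"
    by (intro mult_left_mono grad_sq_le) simp
  with 1 expectation_noise_part_sq_le[of t] expectation_drift_part_sq_le[OF \<theta>]
  show "(\<integral>\<omega>. (norm (mean_grad t \<omega> - grad obj (x t \<omega>)))\<^sup>2 \<partial>M)
      \<le> 16 * L * (\<theta> t)\<^sup>2 * exp_gap M m \<phi> xs x t
        + 4 * (\<theta> t)\<^sup>2 * V_bar1 (node_var m \<phi> xs R) H b + 2 * V_u (node_var m \<phi> xs R) H b"
    by simp
qed

section \<open>The recursion\<close>

text \<open>With step sizes inversely proportional to \<open>H\<close>, every displacement is the same multiple
  \<open>- \<theta> t / L\<close> of the local gradient. Hence the uniform weights produce the step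
  \<open>- (\<theta> t / L) *\<^sub>R mean_grad t \<omega>\<close>, and the minimizing weights do at least as well on the
  surrogate.\<close>

lemma round_descent:
  assumes \<omega>: "\<omega> \<in> space M" and \<Lambda>: "\<Lambda> t * \<theta> t \<le> L / 2"
  shows "obj (x (Suc t) \<omega>) \<le> obj (x t \<omega>) - \<theta> t / (4 * L) * (norm (grad obj (x t \<omega>)))\<^sup>2
    + (\<theta> t / L + 1 / (\<Lambda> t - L)) / 2 * (norm (mean_grad t \<omega> - grad obj (x t \<omega>)))\<^sup>2"
proof -
  let ?\<Delta> = "\<lambda>i. y i t (H i) \<omega> - x t \<omega>"
  let ?c = "\<theta> t / L"
  let ?s = "\<lambda>v :: real^'n. \<Sum>i\<in>UNIV. v $ i *\<^sub>R ?\<Delta> i"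
  define u :: "real^'n" where "u = (\<chi> i. 1 / real CARD('n))"
  have c0: "0 < ?c" using theta_pos L_pos by simp
  have "u \<in> unit_simplex" by (simp add: u_def unit_simplex_def)
  then have opt: "Psi_hom H (step_size L H (\<theta> t)) (\<Lambda> t) ?\<Delta> (w t \<omega>)
      \<le> Psi_hom H (step_size L H (\<theta> t)) (\<Lambda> t) ?\<Delta> u"
    using weights_argmin[OF \<omega>, of t] unfolding is_arg_min_def by (meson not_le)
  have "?s u = - ?c *\<^sub>R mean_grad t \<omega>"
    using theta_pos[of t] L_pos
    by (simp add: u_def mean_grad_def avg_local_grad_def step_size_H
        scaleR_sum_right[symmetric] sum_negf inverse_eq_divide)
  with opt have "obj (x t \<omega> + ?s (w t \<omega>)) \<le> obj (x t \<omega>) - ?c / 4 * (norm (grad obj (x t \<omega>)))\<^sup>2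
    + (?c + 1 / (\<Lambda> t - L)) / 2 * (norm (mean_grad t \<omega> - grad obj (x t \<omega>)))\<^sup>2"
    using c0 \<Lambda> \<Lambda>_gt[of t] L_pos
    by (intro surrogate_descent[OF L_smooth_obj])
      (auto simp: Psi_hom_def mean_grad_def field_simps)
  then show ?thesis by (simp add: server_step[OF \<omega>] mult.commute)
qed

lemma exp_gap_recursion:
  assumes \<Lambda>: "\<Lambda> t * \<theta> t \<le> L / 2"
  shows "exp_gap M m \<phi> xs x (Suc t) \<le>
           T_map (A_hom L R (\<theta> t)) (exp_gap M m \<phi> xs x t)
           + beta_hom L (\<theta> t) (\<Lambda> t) * exp_gap M m \<phi> xs x t
           + delta_hom L (\<theta> t) (\<Lambda> t)
               (V_bar1 (node_var m \<phi> xs R) H b) (V_u (node_var m \<phi> xs R) H b)"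
proof -
  define f where "f = (\<lambda>t \<omega>. obj (x t \<omega>) - obj xs)"
  define e where "e = (\<lambda>\<omega>. (norm (mean_grad t \<omega> - grad obj (x t \<omega>)))\<^sup>2)"
  define A where "A = A_hom L R (\<theta> t)"
  define K where "K = (\<theta> t / L + 1 / (\<Lambda> t - L)) / 2"
  define u where "u = exp_gap M m \<phi> xs x t"
  let ?V1 = "V_bar1 (node_var m \<phi> xs R) H b" and ?Vu = "V_u (node_var m \<phi> xs R) H b"
  have \<theta>0: "0 < \<theta> t" by (rule theta_pos)
  have \<theta>: "\<theta> t \<le> 1 / 2"
  proof -
    have "L * \<theta> t \<le> \<Lambda> t * \<theta> t" using \<Lambda>_gt[of t] \<theta>0 by (intro mult_right_mono) auto
    with \<Lambda> have "L * \<theta> t \<le> L * (1 / 2)" by simp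
    then show ?thesis using L_pos by (simp only: mult_le_cancel_left_pos)
  qed
  have A0: "0 \<le> A" using \<theta>0 L_pos by (simp add: A_def A_hom_def)
  have K0: "0 \<le> K" using \<theta>0 L_pos \<Lambda>_gt[of t] by (simp add: K_def)
  have f0: "0 \<le> f t \<omega>" for t \<omega> by (simp add: f_def obj_min)
  have f_sq: "square_integrable M (f t)" for t
    unfolding f_def by (rule square_integrable_gap)
  have fi: "integrable M (f t)" for t by (rule square_integrable_imp_integrable[OF f_sq])
  have f2i: "integrable M (\<lambda>\<omega>. (f t \<omega>)\<^sup>2)" using square_integrable_norm_sq[OF f_sq, of t] by simp
  have ei: "integrable M e"
    unfolding e_def by (rule expectation_mean_grad_error_sq_le(1)[OF \<theta>])
  have u0: "0 \<le> u" unfolding u_def exp_gap_eq by (rule integral_nonneg_AE) (simp add: obj_min)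
  \<comment> \<open>In the ball, convexity bounds the squared gradient below by \<open>(f t \<omega> / R)\<^sup>2\<close>.\<close>
  have "AE \<omega> in M. f (Suc t) \<omega> \<le> f t \<omega> - A * (f t \<omega>)\<^sup>2 + K * e \<omega>"
    using x_in_ball[of t] AE_space
  proof eventually_elim
    case (elim \<omega>)
    have "f t \<omega> \<le> R * norm (grad obj (x t \<omega>))"
      unfolding f_def by (rule convex_gap_le_norm_grad[OF L_smooth_obj convex_obj elim(1)])
    then have "(f t \<omega>)\<^sup>2 \<le> (R * norm (grad obj (x t \<omega>)))\<^sup>2" using f0 by (rule power_mono)
    then have "A * (f t \<omega>)\<^sup>2 \<le> A * (R * norm (grad obj (x t \<omega>)))\<^sup>2" using A0 by (rule mult_left_mono)
    also have "\<dots> = \<theta> t / (4 * L) * (norm (grad obj (x t \<omega>)))\<^sup>2"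
      using R_pos by (simp add: A_def A_hom_def power_mult_distrib)
    finally show ?case using round_descent[OF elim(2) \<Lambda>] by (simp add: f_def e_def K_def)
  qed
  then have "(\<integral>\<omega>. f (Suc t) \<omega> \<partial>M) \<le> (\<integral>\<omega>. f t \<omega> - A * (f t \<omega>)\<^sup>2 + K * e \<omega> \<partial>M)"
    using fi f2i ei by (intro integral_mono_AE) auto
  also have "\<dots> = (\<integral>\<omega>. f t \<omega> \<partial>M) - A * (\<integral>\<omega>. (f t \<omega>)\<^sup>2 \<partial>M) + K * (\<integral>\<omega>. e \<omega> \<partial>M)"
    using fi f2i ei by simp
  also have "\<dots> \<le> u - A * u\<^sup>2 + K * (16 * L * (\<theta> t)\<^sup>2 * u + 4 * (\<theta> t)\<^sup>2 * ?V1 + 2 * ?Vu)"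
  proof -
    \<comment> \<open>The variance of the gap is nonnegative.\<close>
    have "u\<^sup>2 \<le> (\<integral>\<omega>. (f t \<omega>)\<^sup>2 \<partial>M)"
      using variance_positive[of "f t"] unfolding variance_eq[OF fi f2i]
      by (simp add: u_def exp_gap_eq f_def)
    then have "A * u\<^sup>2 \<le> A * (\<integral>\<omega>. (f t \<omega>)\<^sup>2 \<partial>M)" using A0 by (rule mult_left_mono)
    moreover have "K * (\<integral>\<omega>. e \<omega> \<partial>M) \<le> K * (16 * L * (\<theta> t)\<^sup>2 * u + 4 * (\<theta> t)\<^sup>2 * ?V1 + 2 * ?Vu)"
      unfolding e_def u_def using expectation_mean_grad_error_sq_le(2)[OF \<theta>] K0 by (rule mult_left_mono)
    moreover have "(\<integral>\<omega>. f t \<omega> \<partial>M) = u" by (simp add: u_def exp_gap_eq f_def)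
    ultimately show ?thesis by simp
  qed
  also have "u - A * u\<^sup>2 \<le> T_map A u" by (rule sub_square_le_T_map[OF A0 u0])
  also have "K * (16 * L * (\<theta> t)\<^sup>2 * u + 4 * (\<theta> t)\<^sup>2 * ?V1 + 2 * ?Vu)
      \<le> beta_hom L (\<theta> t) (\<Lambda> t) * u + delta_hom L (\<theta> t) (\<Lambda> t) ?V1 ?Vu"
  proof -
    have V1: "0 \<le> ?V1" unfolding V_bar1_def by (simp add: sum_nonneg node_var_nonneg)
    have "K * (16 * L * (\<theta> t)\<^sup>2) = beta_hom L (\<theta> t) (\<Lambda> t) / 2"
      using L_pos \<Lambda>_gt[of t] by (simp add: K_def beta_hom_def field_simps power3_eq_cube power2_eq_square)
    moreover have "0 \<le> beta_hom L (\<theta> t) (\<Lambda> t)"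
      using L_pos \<Lambda>_gt[of t] \<theta>0 by (simp add: beta_hom_def)
    ultimately have 1: "K * (16 * L * (\<theta> t)\<^sup>2) * u \<le> beta_hom L (\<theta> t) (\<Lambda> t) * u"
      using u0 by (intro mult_right_mono) auto
    have "K * (4 * (\<theta> t)\<^sup>2) = (4 * ((\<theta> t) ^ 3 / L) + 4 * ((\<theta> t)\<^sup>2 / (\<Lambda> t - L))) / 2"
      using L_pos \<Lambda>_gt[of t] by (simp add: K_def field_simps power3_eq_cube power2_eq_square)
    also have "\<dots> \<le> 4 * ((\<theta> t) ^ 3 / L) + 4 * ((\<theta> t)\<^sup>2 / (\<Lambda> t - L))"
    proof -
      have half: "z / 2 \<le> z" if "0 \<le> z" for z :: real using that by simp
      show ?thesis using L_pos \<Lambda>_gt[of t] \<theta>0 by (intro half) simp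
    qed
    finally have 2: "K * (4 * (\<theta> t)\<^sup>2) * ?V1
        \<le> (4 * ((\<theta> t) ^ 3 / L) + 4 * ((\<theta> t)\<^sup>2 / (\<Lambda> t - L))) * ?V1"
      using V1 by (rule mult_right_mono)
    have 3: "K * 2 * ?Vu = (\<theta> t / L + 1 / (\<Lambda> t - L)) * ?Vu" by (simp add: K_def)
    have "K * (16 * L * (\<theta> t)\<^sup>2 * u + 4 * (\<theta> t)\<^sup>2 * ?V1 + 2 * ?Vu)
        = K * (16 * L * (\<theta> t)\<^sup>2) * u + K * (4 * (\<theta> t)\<^sup>2) * ?V1 + K * 2 * ?Vu"
      by (simp add: algebra_simps)
    with 1 2 3 show ?thesis unfolding delta_hom_def by linarith
  qed
  finally show ?thesis
    unfolding f_def[symmetric] by (simp add: exp_gap_eq f_def A_def u_def)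
qed

end

theorem theorem4p4:
  fixes M :: "'w measure"
    and m :: "'n::finite \<Rightarrow> nat"
    and \<phi> :: "'n \<Rightarrow> nat \<Rightarrow> real^'d \<Rightarrow> real"
    and L R :: real and xs :: "real^'d"
    and H b :: "'n \<Rightarrow> nat"
    and \<theta>lo \<theta>hi :: real and \<theta> \<Lambda> :: "nat \<Rightarrow> real"
    and B :: "'n \<Rightarrow> nat \<Rightarrow> nat \<Rightarrow> 'w \<Rightarrow> nat list"
    and g y :: "'n \<Rightarrow> nat \<Rightarrow> nat \<Rightarrow> 'w \<Rightarrow> real^'d"
    and w :: "nat \<Rightarrow> 'w \<Rightarrow> real^'n"
    and x :: "nat \<Rightarrow> 'w \<Rightarrow> real^'d"
  assumes "hom_post_local M m \<phi> L xs R H b \<theta>lo \<theta>hi \<theta> \<Lambda> B g y w x"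
    and "\<And>t. L < \<Lambda> t \<and> \<Lambda> t \<le> 2 * L"
    and "\<And>t. \<Lambda> t * \<theta> t \<le> L / 2"
  shows "\<forall>t. exp_gap M m \<phi> xs x (Suc t) \<le>
           T_map (A_hom L R (\<theta> t)) (exp_gap M m \<phi> xs x t)
           + beta_hom L (\<theta> t) (\<Lambda> t) * exp_gap M m \<phi> xs x t
           + delta_hom L (\<theta> t) (\<Lambda> t)
               (V_bar1 (node_var m \<phi> xs R) H b) (V_u (node_var m \<phi> xs R) H b)"
proof
  fix t
  interpret hom_post_local M m \<phi> L xs R H b \<theta>lo \<theta>hi \<theta> \<Lambda> B g y w x
    by (rule assms(1))
  show "exp_gap M m \<phi> xs x (Suc t) \<le>
           T_map (A_hom L R (\<theta> t)) (exp_gap M m \<phi> xs x t)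
           + beta_hom L (\<theta> t) (\<Lambda> t) * exp_gap M m \<phi> xs x t
           + delta_hom L (\<theta> t) (\<Lambda> t)
               (V_bar1 (node_var m \<phi> xs R) H b) (V_u (node_var m \<phi> xs R) H b)"
    by (rule exp_gap_recursion[OF assms(3)])
qed

end
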